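(* Let $\mathbf{m}=(m_0,\dots,m_\ell)$ be a multiplicity vector of magnitude $n$, and let $\mathcal{B}$ be a skewed binary partition of $[0,n]$. Then $\mathcal{B}\in\mathcal{SBP}(\mathbf{m})$ if and only if $\mathrm{type}(\mathcal{B})=(b_{-1},b_0,\dots,b_p)$ satisfies the following conditions: (1) $0<|b_{-1}|+|b_0|\le m_0$ if and only if $b_0=0$ (the undecorated symbol $0$, as opposed to $0^\circ$). (2) $m_0<|b_{-1}|+|b_0|+|b_1|$ (if $p=0$, this inequality is read as $m_0<|b_{-1}|+|b_0|$), and for every positive integer $i\le\ell$ there exists at most one positive integer $j$ (with $j\le p$) such that $$m_0+\cdots+m_{i-1}\le|b_{-1}|+\cdots+|b_{j-1}|<|b_{-1}|+\cdots+|b_j|\le m_0+\cdots+m_i.\qquad( * )$$ (3) For $1\le j\le p$: if there exists a positive integer $i\le\ell$ satisfying $( * )$, then $b_j$ is an undecorated positive integer; otherwise $b_j\in\mathbb{P}^\star_{\ge2}$, i.e. $b_j$ is a $\star$-decorated integer.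
   Context: A multiplicity vector of magnitude $n$ is a tuple $\mathbf{m}=(m_0,m_1,\dots,m_\ell)$ of integers with $\ell\ge1$, $m_0\ge0$, $m_1,\dots,m_\ell\ge1$ and $m_0+\cdots+m_\ell=n$. Skewed binary partitions. A skewed binary partition of $[0,n]=\{0,\dots,n\}$ is an ordered tuple $\mathcal{B}=(B_{-1},B_0,B_1,\dots,B_k)$, $k\ge0$, of disjoint subsets with union $[0,n]$, each labelled homogeneous or non-homogeneous, such that: $B_{-1}$ is non-homogeneous, and $B_0$ is homogeneous if $|B_0|\ge2$; $0\in B_{-1}\cup B_0$, and if $0\in B_{-1}$ then $|B_{-1}|\ge2$ and $B_0=\emptyset$; for $0\le i\le k$, if $B_i$ is a singleton it is non-homogeneous; $B_i\ne\emptyset$ for $1\le i\le k$. Preorder. $\preceq_{\mathcal{B}}$ is the preorder on $[0,n]$ with $p\preceq_{\mathcal{B}}q$ iff $p=q$, or $p\in B_i,q\in B_j$ with $i<j$, or $p,q$ lie in a common homogeneous block. Contraction. A preorder $\preceq$ has equivalence classes under $i\equiv j\iff i\preceq j\preceq i$ and induces a partial order on them; its Hasse diagram is that of this poset of classes. A preorder $\preceq_1$ is a contraction of $\preceq_2$ if its Hasse diagram is obtained from that of $\preceq_2$ by a (possibly empty) sequence of edge contractions, where contracting an edge $\bar g\lessdot\bar h$ merges the classes $\bar g,\bar h$, the new preorder being the transitive closure of the old one together with $\bar h\preceq\bar g$. A skewed binary partition $\mathcal{C}$ is a contraction of $\mathcal{B}$ if $\preceq_{\mathcal{C}}$ is a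 contraction of $\preceq_{\mathcal{B}}$. Type. $\mathrm{type}(\mathcal{B})=(b_{-1},b_0,\dots,b_k)$, where entries are nonnegative integers, possibly decorated by $\circ$ or $\star$: for $1\le i\le k$, $b_i=|B_i|$ if $B_i$ is non-homogeneous and $b_i=|B_i|^\star$ if homogeneous; if $0\in B_0$ then $b_0=(|B_0|-1)^\circ$ and $b_{-1}=|B_{-1}|$; if $0\in B_{-1}$ then $b_0=0$ (undecorated, distinct from $0^\circ$) and $b_{-1}=|B_{-1}|-1$. The absolute value takes the numerical value: $|i|=|i^\circ|=|i^\star|=i$. $\mathbb{P}^\star_{\ge2}=\{i^\star : i\ge2\}$. $\Omega_{\mathbf{m}}$. Let $r=m_1+\cdots+m_\ell$. $\Omega_{\mathbf{m}}=\{\mathbf{a}_0,\dots,\mathbf{a}_r\}$, where $\mathbf{a}_0=(m_0,0,m_1,\dots,m_\ell)$ if $m_0>0$, $\mathbf{a}_0=(0,0^\circ,m_1,\dots,m_\ell)$ if $m_0=0$; for $1\le i<r$, $\mathbf{a}_i=(m_0+i,0^\circ,m_1+\cdots+m_g-i,m_{g+1},\dots,m_\ell)$, where $g$ is the unique positive integer with $m_1+\cdots+m_{g-1}\le i<m_1+\cdots+m_g$; and $\mathbf{a}_r=(n,0^\circ)$. $\mathcal{SBP}(\mathbf{m})$ is the set of all skewed binary partitions of $[0,n]$ that are contractions of some skewed binary partition $\mathcal{A}$ with $\mathrm{type}(\mathcal{A})\in\Omega_{\mathbf{m}}$. *)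

theory Defs
  imports Main
begin

text \<open>A multiplicity vector \<open>(m\<^sub>0, \<dots>, m\<^sub>\<ell>)\<close> is the list \<open>m\<close> of length \<open>\<ell> + 1\<close> with \<open>m ! i = m\<^sub>i\<close>.\<close>

definition multiplicity_vector :: "nat \<Rightarrow> nat list \<Rightarrow> bool" where
  "multiplicity_vector n m \<longleftrightarrow>
     length m \<ge> 2 \<and> (\<forall>i. 1 \<le> i \<and> i < length m \<longrightarrow> m ! i \<ge> 1) \<and> sum_list m = n"

datatype block = is_hom: Hom (elems: "nat set") | Nonhom (elems: "nat set")

text \<open>A tuple \<open>(B\<^sub>-\<^sub>1, B\<^sub>0, \<dots>, B\<^sub>k)\<close> is a list \<open>B\<close> of length \<open>k + 2\<close>. Indices are shifted by one:
  \<open>B ! i\<close> is the block \<open>B\<close> with index \<open>i - 1\<close>, so \<open>B ! 0\<close> is \<open>B\<^sub>-\<^sub>1\<close> and \<open>B ! 1\<close> is \<open>B\<^sub>0\<close>.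
  An empty \<open>B\<^sub>0\<close> may carry either label; neither the preorder nor the type depends on it.\<close>

definition skewed_binary_partition :: "nat \<Rightarrow> block list \<Rightarrow> bool" where
  "skewed_binary_partition n B \<longleftrightarrow>
     length B \<ge> 2 \<and>
     (\<Union>X \<in> set B. elems X) = {0..n} \<and>
     (\<forall>i j. i < length B \<and> j < length B \<and> i \<noteq> j \<longrightarrow> elems (B ! i) \<inter> elems (B ! j) = {}) \<and>
     \<not> is_hom (B ! 0) \<and>
     (card (elems (B ! 1)) \<ge> 2 \<longrightarrow> is_hom (B ! 1)) \<and>
     0 \<in> elems (B ! 0) \<union> elems (B ! 1) \<and>
     (0 \<in> elems (B ! 0) \<longrightarrow> card (elems (B ! 0)) \<ge> 2 \<and> elems (B ! 1) = {}) \<and>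
     (\<forall>i. 1 \<le> i \<and> i < length B \<and> card (elems (B ! i)) = 1 \<longrightarrow> \<not> is_hom (B ! i)) \<and>
     (\<forall>i. 2 \<le> i \<and> i < length B \<longrightarrow> elems (B ! i) \<noteq> {})"

definition sbp_preorder :: "nat \<Rightarrow> block list \<Rightarrow> nat rel" where
  "sbp_preorder n B = {(p, q). p \<in> {0..n} \<and> q \<in> {0..n} \<and>
     (p = q \<or>
      (\<exists>i j. i < j \<and> j < length B \<and> p \<in> elems (B ! i) \<and> q \<in> elems (B ! j)) \<or>
      (\<exists>i < length B. is_hom (B ! i) \<and> p \<in> elems (B ! i) \<and> q \<in> elems (B ! i)))}"

text \<open>In what follows \<open>r\<close> is a preorder on \<open>A\<close>; its classes are those of the equivalence \<open>r \<inter> r\<inverse>\<close>.\<close>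

definition preorder_classes :: "'a set \<Rightarrow> 'a rel \<Rightarrow> 'a set set" where
  "preorder_classes A r = A // (r \<inter> r\<inverse>)"

definition class_le :: "'a rel \<Rightarrow> 'a set \<Rightarrow> 'a set \<Rightarrow> bool" where
  "class_le r G H \<longleftrightarrow> (\<exists>g \<in> G. \<exists>h \<in> H. (g, h) \<in> r)"

definition hasse_edge :: "'a set \<Rightarrow> 'a rel \<Rightarrow> 'a set \<Rightarrow> 'a set \<Rightarrow> bool" where
  "hasse_edge A r G H \<longleftrightarrow>
     G \<in> preorder_classes A r \<and> H \<in> preorder_classes A r \<and> G \<noteq> H \<and> class_le r G H \<and>
     \<not> (\<exists>K \<in> preorder_classes A r. K \<noteq> G \<and> K \<noteq> H \<and> class_le r G K \<and> class_le r K H)"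

definition contract_edge :: "'a rel \<Rightarrow> 'a set \<Rightarrow> 'a set \<Rightarrow> 'a rel" where
  "contract_edge r G H = (r \<union> H \<times> G)\<^sup>+"

definition edge_contraction :: "'a set \<Rightarrow> 'a rel \<Rightarrow> 'a rel \<Rightarrow> bool" where
  "edge_contraction A r s \<longleftrightarrow> (\<exists>G H. hasse_edge A r G H \<and> s = contract_edge r G H)"

definition preorder_contraction :: "'a set \<Rightarrow> 'a rel \<Rightarrow> 'a rel \<Rightarrow> bool" where
  "preorder_contraction A r1 r2 \<longleftrightarrow> (edge_contraction A)\<^sup>*\<^sup>* r2 r1"

definition sbp_contraction :: "nat \<Rightarrow> block list \<Rightarrow> block list \<Rightarrow> bool" where
  "sbp_contraction n C B \<longleftrightarrow>
     preorder_contraction {0..n} (sbp_preorder n C) (sbp_preorder n B)"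

text \<open>Entries \<open>i\<close>, \<open>i\<^sup>\<circ>\<close> and \<open>i\<^sup>\<star>\<close> of a type, with their absolute value.\<close>

datatype type_entry = Plain (absval: nat) | Circ (absval: nat) | Star (absval: nat)

text \<open>A type \<open>(b\<^sub>-\<^sub>1, b\<^sub>0, \<dots>, b\<^sub>k)\<close> is a list with the same index shift as the partition.\<close>

definition sbp_type :: "block list \<Rightarrow> type_entry list" where
  "sbp_type B =
     (if 0 \<in> elems (B ! 1)
      then [Plain (card (elems (B ! 0))), Circ (card (elems (B ! 1)) - 1)]
      else [Plain (card (elems (B ! 0)) - 1), Plain 0]) @
     map (\<lambda>X. if is_hom X then Star (card (elems X)) else Plain (card (elems X))) (drop 2 B)"

definition P_star_ge2 :: "type_entry set" where
  "P_star_ge2 = {Star i | i. i \<ge> 2}"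

definition Omega :: "nat list \<Rightarrow> type_entry list set" where
  "Omega m =
     {Plain (m ! 0) # (if m ! 0 > 0 then Plain 0 else Circ 0) # map Plain (drop 1 m)} \<union>
     {Plain (m ! 0 + i) # Circ 0 # Plain ((\<Sum>t = 1..g. m ! t) - i) # map Plain (drop (g + 1) m)
        | i g. 1 \<le> i \<and> i < (\<Sum>t = 1..<length m. m ! t) \<and>
               1 \<le> g \<and> g < length m \<and> (\<Sum>t = 1..<g. m ! t) \<le> i \<and> i < (\<Sum>t = 1..g. m ! t)} \<union>
     {[Plain (sum_list m), Circ 0]}"

definition SBP :: "nat list \<Rightarrow> block list set" where
  "SBP m = {B. skewed_binary_partition (sum_list m) B \<and>
     (\<exists>A. skewed_binary_partition (sum_list m) A \<and> sbp_type A \<in> Omega m \<and>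
          sbp_contraction (sum_list m) B A)}"

text \<open>\<open>m\<^sub>0 + \<dots> + m\<^sub>i\<close>, and \<open>|b\<^sub>-\<^sub>1| + |b\<^sub>0| + \<dots> + |b\<^sub>j|\<close> with the index shift for \<open>b\<close>.\<close>

definition msum :: "nat list \<Rightarrow> nat \<Rightarrow> nat" where
  "msum m i = (\<Sum>t \<le> i. m ! t)"

definition bsum :: "type_entry list \<Rightarrow> nat \<Rightarrow> nat" where
  "bsum b j = (\<Sum>t \<le> j + 1. absval (b ! t))"

text \<open>The block with index \<open>j \<ge> 1\<close> lies within the range of the multiplicity \<open>m\<^sub>i\<close>, \<open>i \<ge> 1\<close>.\<close>

definition block_within :: "nat list \<Rightarrow> type_entry list \<Rightarrow> nat \<Rightarrow> nat \<Rightarrow> bool" where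
  "block_within m b i j \<longleftrightarrow>
     msum m (i - 1) \<le> bsum b (j - 1) \<and> bsum b (j - 1) < bsum b j \<and> bsum b j \<le> msum m i"

end

(*
  A contraction of an ordered sum of antichains is again an ordered sum of antichains and merged
  classes. It is reachable by edge contractions exactly if it extends the original preorder, two
  singleton classes from one original antichain stay incomparable, and every merged class meets two
  of the original antichains: while some class is not yet merged, it contains two comparable elements
  with nothing in between, and contracting this edge preserves the conditions. With the type a_i
  encoded by its first entry K = m_0 + i, membership in SBP(m) therefore means that the elements can be
  given levels with prescribed counts that satisfy these three conditions with respect to B.
  Comparing down-sets of levels with down-sets of blocks turns this into the inequalities of the
  statement. Conversely, one lists the elements along the blocks, with 0 first in its block at
  position q, puts K = max(m_0, q), and cuts the list at K and at the sums m_0 + ... + m_i > K.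
*)
theory Submission
  imports Defs
begin

section \<open>Edge contractions of layered preorders\<close>

text \<open>The form that survives contraction is a layer function \<open>f\<close> with a flag
  \<open>h\<close> telling which layers are one class and which are antichains, so a contraction
  sequence becomes arithmetic on layers. The later case distinctions come from the element
  \<open>0\<close>: it shares level 0 with others if \<open>K = m ! 0 \<and> 0 < K\<close>, and is
  alone on level 1 otherwise. The second case explains the \<open>K\<close> of the converse:
  \<open>0\<close> then comes last among the \<open>Suc K\<close> lowest elements, so
  \<open>K\<close> must be its position; in the first case \<open>K\<close> is \<open>m ! 0\<close>,
  and \<open>0\<close> only has to be among these elements. Levels and blocks can be compared by
  counting because \<open>L x < L y\<close> never reverses the order of blocks: of two down-sets,
  one always contains the other.\<close>

definition layered_preorder :: "'a set \<Rightarrow> ('a \<Rightarrow> nat) \<Rightarrow> (nat \<Rightarrow> bool) \<Rightarrow> 'a rel" where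
  "layered_preorder S f h =
     {(p, q). p \<in> S \<and> q \<in> S \<and> (p = q \<or> f p < f q \<or> (f p = f q \<and> h (f p)))}"

definition layered_class :: "'a set \<Rightarrow> ('a \<Rightarrow> nat) \<Rightarrow> (nat \<Rightarrow> bool) \<Rightarrow> 'a \<Rightarrow> 'a set" where
  "layered_class S f h x = {z \<in> S. z = x \<or> (f z = f x \<and> h (f x))}"

text \<open>Layers are doubled so that the odd number \<open>2 * f y - 1\<close> is free for the merged class of \<open>x\<close> and
  \<open>y\<close>: it lies above the rest of the layer of \<open>x\<close> and below the rest of the layer of \<open>y\<close>.\<close>

definition merged_layer ::
  "'a set \<Rightarrow> ('a \<Rightarrow> nat) \<Rightarrow> (nat \<Rightarrow> bool) \<Rightarrow> 'a \<Rightarrow> 'a \<Rightarrow> 'a \<Rightarrow> nat" where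
  "merged_layer S f h x y z =
     (if z \<in> layered_class S f h x \<union> layered_class S f h y then 2 * f y - 1 else 2 * f z)"

text \<open>Odd values belong to the merged class alone; an even layer \<open>2 * k\<close> keeps
  the label of \<open>k\<close>.\<close>

definition merged_hom :: "(nat \<Rightarrow> bool) \<Rightarrow> nat \<Rightarrow> bool" where
  "merged_hom h k \<longleftrightarrow> odd k \<or> h (k div 2)"

lemma layered_preorder_iff:
  "(p, q) \<in> layered_preorder S f h \<longleftrightarrow>
     p \<in> S \<and> q \<in> S \<and> (p = q \<or> f p < f q \<or> (f p = f q \<and> h (f p)))"
  by (simp add: layered_preorder_def)

lemma trans_layered_preorder: "trans (layered_preorder S f h)"
  unfolding trans_def layered_preorder_iff by auto

lemma preorder_classes_layered:
  "preorder_classes S (layered_preorder S f h) = layered_class S f h ` S"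
proof -
  have "(layered_preorder S f h \<inter> (layered_preorder S f h)\<inverse>) `` {x} = layered_class S f h x"
    if "x \<in> S" for x
    using that by (auto simp: layered_preorder_iff layered_class_def)
  then show ?thesis
    unfolding preorder_classes_def quotient_def by auto
qed

lemma class_le_layered:
  assumes "x \<in> S" "y \<in> S"
  shows "class_le (layered_preorder S f h) (layered_class S f h x) (layered_class S f h y) \<longleftrightarrow>
    (x, y) \<in> layered_preorder S f h"
  using assms unfolding class_le_def layered_preorder_iff layered_class_def by auto

lemma layered_class_eq_iff:
  assumes "x \<in> S" "y \<in> S"
  shows "layered_class S f h x = layered_class S f h y \<longleftrightarrow> x = y \<or> (f x = f y \<and> h (f x))"
  using assms unfolding layered_class_def by auto

text \<open>Distinct classes are comparable exactly when their layers differ, so covering means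
  being on consecutive occupied layers.\<close>

lemma hasse_edge_layered:
  "hasse_edge S (layered_preorder S f h) G H \<longleftrightarrow>
     (\<exists>x\<in>S. \<exists>y\<in>S. G = layered_class S f h x \<and> H = layered_class S f h y \<and> f x < f y \<and>
        \<not> (\<exists>z\<in>S. f x < f z \<and> f z < f y))"
proof -
  let ?c = "layered_class S f h" and ?r = "layered_preorder S f h"
  have lt: "?c x \<noteq> ?c y \<and> class_le ?r (?c x) (?c y) \<longleftrightarrow> f x < f y" if "x \<in> S" "y \<in> S" for x y
    using that by (auto simp: class_le_layered layered_class_eq_iff layered_preorder_iff)
  have edge: "hasse_edge S ?r (?c x) (?c y) \<longleftrightarrow> f x < f y \<and> \<not> (\<exists>z\<in>S. f x < f z \<and> f z < f y)"
    if "x \<in> S" "y \<in> S" for x y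
  proof -
    have "hasse_edge S ?r (?c x) (?c y) \<longleftrightarrow> (?c x \<noteq> ?c y \<and> class_le ?r (?c x) (?c y)) \<and>
        \<not> (\<exists>z\<in>S. (?c x \<noteq> ?c z \<and> class_le ?r (?c x) (?c z)) \<and>
          (?c z \<noteq> ?c y \<and> class_le ?r (?c z) (?c y)))"
      unfolding hasse_edge_def preorder_classes_layered using that by auto
    then show ?thesis
      using lt that by (simp cong: bex_cong)
  qed
  show ?thesis
  proof
    assume e: "hasse_edge S ?r G H"
    then obtain x y where "x \<in> S" "y \<in> S" "G = ?c x" "H = ?c y"
      unfolding hasse_edge_def preorder_classes_layered by auto
    then show "\<exists>x\<in>S. \<exists>y\<in>S. G = ?c x \<and> H = ?c y \<and> f x < f y \<and> \<not> (\<exists>z\<in>S. f x < f z \<and> f z < f y)"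
      using e edge by metis
  next
    assume "\<exists>x\<in>S. \<exists>y\<in>S. G = ?c x \<and> H = ?c y \<and> f x < f y \<and> \<not> (\<exists>z\<in>S. f x < f z \<and> f z < f y)"
    then show "hasse_edge S ?r G H"
      using edge by metis
  qed
qed

text \<open>What else shares the layer of \<open>x\<close> was already below \<open>y\<close> and so
  falls below the merged class; what else shares the layer of \<open>y\<close> was above
  \<open>x\<close> and so lies above it. One inclusion holds because the layered preorder is
  transitive and contains the generators, the other because the reversed edge makes the two classes
  strongly connected.\<close>

lemma contract_edge_layered:
  assumes x: "x \<in> S" and y: "y \<in> S" and xy: "f x < f y"
    and gap: "\<not> (\<exists>z\<in>S. f x < f z \<and> f z < f y)"
  shows "contract_edge (layered_preorder S f h) (layered_class S f h x) (layered_class S f h y) =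
    layered_preorder S (merged_layer S f h x y) (merged_hom h)"
    (is "contract_edge ?r ?X ?Y = ?s")
proof
  let ?T = "(?r \<union> ?Y \<times> ?X)\<^sup>+"
  have X: "z \<in> S \<and> (z = x \<or> (f z = f x \<and> h (f x)))" if "z \<in> ?X" for z
    using that by (auto simp: layered_class_def)
  have Y: "z \<in> S \<and> (z = y \<or> (f z = f y \<and> h (f y)))" if "z \<in> ?Y" for z
    using that by (auto simp: layered_class_def)
  have layer: "f u = f x \<or> f u = f y" if "u \<in> ?X \<union> ?Y" for u
    using that by (auto simp: layered_class_def)
  \<comment> \<open>A homogeneous layer lies entirely inside or entirely outside the merged
    class.\<close>
  have closed: "u \<in> ?X \<union> ?Y \<longleftrightarrow> v \<in> ?X \<union> ?Y"
    if "u \<in> S" "v \<in> S" "f u = f v" "h (f u)" for u v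
    using that by (auto simp: layered_class_def)
  have xX: "x \<in> ?X" and yY: "y \<in> ?Y"
    using x y by (auto simp: layered_class_def)
  have "?r \<subseteq> ?s"
  proof
    fix e assume "e \<in> ?r"
    then obtain p q where e: "e = (p, q)" and pq: "(p, q) \<in> ?r" by (cases e) auto
    then have S: "p \<in> S" "q \<in> S"
      and le: "p = q \<or> f p < f q \<or> (f p = f q \<and> h (f p))"
      by (auto simp: layered_preorder_iff)
    have "p = q \<or> merged_layer S f h x y p < merged_layer S f h x y q \<or>
      merged_layer S f h x y p = merged_layer S f h x y q \<and> merged_hom h (merged_layer S f h x y p)"
    proof (cases "p \<in> ?X \<union> ?Y"; cases "q \<in> ?X \<union> ?Y")
      assume "p \<in> ?X \<union> ?Y" "q \<in> ?X \<union> ?Y"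
      then show ?thesis
        using xy by (simp add: merged_layer_def merged_hom_def)
    next
      assume p: "p \<in> ?X \<union> ?Y" and q: "q \<notin> ?X \<union> ?Y"
      then have "f p < f q"
        using le p closed[OF S] by metis
      \<comment> \<open>The layer of \<open>p\<close> is that of \<open>x\<close> or
        \<open>y\<close>, and no occupied layer is in between; so \<open>q\<close> stays above
        \<open>2 * f y - 1\<close>.\<close>
      then have "f y \<le> f q"
        using layer[OF p] S(2) gap by (metis less_or_eq_imp_le not_le)
      then show ?thesis
        using p q xy by (auto simp: merged_layer_def)
    next
      assume p: "p \<notin> ?X \<union> ?Y" and q: "q \<in> ?X \<union> ?Y"
      then have "f p < f q"
        using le q closed[OF S] by metis
      then have "f p < f y"
        using layer[OF q] xy by auto
      then have "2 * f p < 2 * f y - 1"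
        by linarith
      then show ?thesis
        using p q by (simp add: merged_layer_def)
    next
      assume "p \<notin> ?X \<union> ?Y" "q \<notin> ?X \<union> ?Y"
      then show ?thesis
        using le by (auto simp: merged_layer_def merged_hom_def)
    qed
    then show "e \<in> ?s"
      using S e by (simp add: layered_preorder_iff)
  qed
  moreover have "?Y \<times> ?X \<subseteq> ?s"
    using xy by (auto simp: layered_preorder_iff merged_layer_def merged_hom_def
        layered_class_def)
  ultimately have "?T \<subseteq> ?s\<^sup>+"
    by (intro trancl_mono_subset Un_least)
  then show "contract_edge ?r ?X ?Y \<subseteq> ?s"
    by (simp add: contract_edge_def trancl_id trans_layered_preorder)
  have r: "(p, q) \<in> ?T" if "(p, q) \<in> ?r" for p q
    using that by blast
  have down: "(p, q) \<in> ?T" if "p \<in> ?Y" "q \<in> ?X" for p q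
    using that by blast
  have up: "(p, q) \<in> ?T" if "p \<in> ?X" "q \<in> ?Y" for p q
    using X[OF that(1)] Y[OF that(2)] xy by (intro r) (auto simp: layered_preorder_iff)
  have tr: "(p, q) \<in> ?T" if "(p, z) \<in> ?T" "(z, q) \<in> ?T" for p z q
    using that by (rule trancl_trans)
  \<comment> \<open>All connections are routed through \<open>x\<close>, which is reached from
    \<open>?X\<close> by going up to \<open>y\<close> and down again.\<close>
  have conn: "(u, v) \<in> ?T" if "u \<in> ?X \<union> ?Y" "v \<in> ?X \<union> ?Y" for u v
  proof (rule tr)
    show "(u, x) \<in> ?T"
      using that(1) tr[OF up[OF _ yY] down[OF yY xX]] down[OF _ xX] by blast
    show "(x, v) \<in> ?T"
      using that(2) tr[OF up[OF xX yY] down[OF yY]] up[OF xX] by blast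
  qed
  show "?s \<subseteq> contract_edge ?r ?X ?Y"
  proof
    fix e assume "e \<in> ?s"
    then obtain p q where e: "e = (p, q)" and pq: "(p, q) \<in> ?s" by (cases e) auto
    then have S: "p \<in> S" "q \<in> S"
      and le: "p = q \<or> merged_layer S f h x y p < merged_layer S f h x y q \<or>
      merged_layer S f h x y p = merged_layer S f h x y q \<and> merged_hom h (merged_layer S f h x y p)"
      by (auto simp: layered_preorder_iff)
    have "(p, q) \<in> ?T"
    proof (cases "p \<in> ?X \<union> ?Y"; cases "q \<in> ?X \<union> ?Y")
      assume "p \<in> ?X \<union> ?Y" "q \<in> ?X \<union> ?Y"
      then show ?thesis
        by (rule conn)
    next
      assume p: "p \<in> ?X \<union> ?Y" and q: "q \<notin> ?X \<union> ?Y"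
      then have "p \<noteq> q" "merged_layer S f h x y p = 2 * f y - 1"
        "merged_layer S f h x y q = 2 * f q"
        by (auto simp: merged_layer_def)
      \<comment> \<open>Parity; the subtraction is exact because \<open>f x < f y\<close> gives
        \<open>f y \<ge> 1\<close>.\<close>
      moreover have "2 * f y - 1 \<noteq> 2 * f q"
        using xy by presburger
      ultimately have "2 * f y - 1 < 2 * f q"
        using le by auto
      then have "(x, q) \<in> ?T"
        using xy x S by (intro r) (auto simp: layered_preorder_iff)
      then show ?thesis
        using tr conn p xX by blast
    next
      assume p: "p \<notin> ?X \<union> ?Y" and q: "q \<in> ?X \<union> ?Y"
      then have "p \<noteq> q" "merged_layer S f h x y q = 2 * f y - 1"
        "merged_layer S f h x y p = 2 * f p"
        by (auto simp: merged_layer_def)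
      moreover have "2 * f y - 1 \<noteq> 2 * f p"
        using xy by presburger
      ultimately have "2 * f p < 2 * f y - 1"
        using le by auto
      then have "(p, y) \<in> ?T"
        using y S by (intro r) (auto simp: layered_preorder_iff)
      then show ?thesis
        using tr conn q yY by blast
    next
      assume "p \<notin> ?X \<union> ?Y" "q \<notin> ?X \<union> ?Y"
      then show ?thesis
        using le S by (intro r) (auto simp: merged_layer_def merged_hom_def layered_preorder_iff)
    qed
    then show "e \<in> contract_edge ?r ?X ?Y"
      using e by (simp add: contract_edge_def)
  qed
qed

text \<open>For \<open>s\<close> to arise from the layers \<open>f\<close> by merging classes that are connected in the Hasse diagram,
  two elements of a common layer can only become comparable if one of them is merged with something
  else, and every merged class has to leave its layer.\<close>

definition collapses :: "'a set \<Rightarrow> ('a \<Rightarrow> nat) \<Rightarrow> (nat \<Rightarrow> bool) \<Rightarrow> 'a rel \<Rightarrow> bool" where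
  "collapses S f h s \<longleftrightarrow>
     layered_preorder S f h \<subseteq> s \<and>
     (\<forall>p q. (p, q) \<in> s \<and> p \<noteq> q \<and> f p = f q \<longrightarrow>
        (\<exists>z. z \<noteq> p \<and> (p, z) \<in> s \<and> (z, p) \<in> s) \<or> (\<exists>z. z \<noteq> q \<and> (q, z) \<in> s \<and> (z, q) \<in> s)) \<and>
     (\<forall>p q. p \<noteq> q \<and> (p, q) \<in> s \<and> (q, p) \<in> s \<longrightarrow>
        (f p = f q \<and> h (f p)) \<or> (\<exists>z. (p, z) \<in> s \<and> (z, p) \<in> s \<and> f z \<noteq> f p))"

text \<open>Only the class of \<open>x\<close> and \<open>y\<close> is new. If \<open>L\<close> were
  constant on it, then by the third condition neither \<open>x\<close> nor \<open>y\<close> would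
  have been equivalent to another element, and the second condition would forbid \<open>x\<close>
  below \<open>y\<close>.\<close>

lemma collapses_step:
  assumes col: "collapses S L (\<lambda>_. False) (layered_preorder S f h)"
    and x: "x \<in> S" and y: "y \<in> S" and xy: "f x < f y"
    and gap: "\<not> (\<exists>z\<in>S. f x < f z \<and> f z < f y)"
  shows "collapses S L (\<lambda>_. False) (layered_preorder S (merged_layer S f h x y) (merged_hom h))"
    (is "collapses S L _ ?s")
proof -
  let ?r = "layered_preorder S f h"
  let ?X = "layered_class S f h x" and ?Y = "layered_class S f h y"
  have rs: "?r \<subseteq> ?s"
    unfolding contract_edge_layered[OF x y xy gap, symmetric] contract_edge_def by auto
  have base: "layered_preorder S L (\<lambda>_. False) \<subseteq> ?r"
    and c2: "\<And>p q. (p, q) \<in> ?r \<Longrightarrow> p \<noteq> q \<Longrightarrow> L p = L q \<Longrightarrow>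
        (\<exists>z. z \<noteq> p \<and> (p, z) \<in> ?r \<and> (z, p) \<in> ?r) \<or> (\<exists>z. z \<noteq> q \<and> (q, z) \<in> ?r \<and> (z, q) \<in> ?r)"
    and c3: "\<And>p q. p \<noteq> q \<Longrightarrow> (p, q) \<in> ?r \<Longrightarrow> (q, p) \<in> ?r \<Longrightarrow>
        \<exists>z. (p, z) \<in> ?r \<and> (z, p) \<in> ?r \<and> L z \<noteq> L p"
    using col unfolding collapses_def by blast+
  have merged: "(p, q) \<in> ?s" if "p \<in> ?X \<union> ?Y" "q \<in> ?X \<union> ?Y" for p q
    using that xy by (auto simp: layered_preorder_iff merged_layer_def merged_hom_def
        layered_class_def)
  have outside: "(p, q) \<in> ?r" if "p \<notin> ?X \<union> ?Y" "q \<notin> ?X \<union> ?Y" "(p, q) \<in> ?s" for p q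
    using that by (auto simp: layered_preorder_iff merged_layer_def merged_hom_def)
  have other: "\<exists>z \<in> ?X \<union> ?Y. z \<noteq> p" for p
  proof -
    have "x \<in> ?X \<union> ?Y" "y \<in> ?X \<union> ?Y" "x \<noteq> y"
      using x y xy by (auto simp: layered_class_def)
    then show ?thesis by metis
  qed
  \<comment> \<open>Merged elements have odd layers, all others even ones.\<close>
  have mixed: "p \<in> ?X \<union> ?Y \<longleftrightarrow> q \<in> ?X \<union> ?Y" if "(p, q) \<in> ?s" "(q, p) \<in> ?s" for p q
  proof (rule ccontr)
    assume "\<not> ?thesis"
    moreover have "merged_layer S f h x y p = merged_layer S f h x y q"
      using that by (auto simp: layered_preorder_iff)
    ultimately show False
      using xy by (auto simp: merged_layer_def split: if_splits) presburger+
  qed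
  have "\<exists>z. (p, z) \<in> ?s \<and> (z, p) \<in> ?s \<and> L z \<noteq> L p"
    if pq: "p \<noteq> q" "(p, q) \<in> ?s" "(q, p) \<in> ?s" for p q
  proof (cases "p \<in> ?X \<union> ?Y")
    case True
    have "\<exists>u\<in>?X \<union> ?Y. \<exists>v\<in>?X \<union> ?Y. L u \<noteq> L v"
    proof (rule ccontr)
      assume const: "\<not> ?thesis"
      have single: "z = u" if u: "u \<in> {x, y}" and uz: "(u, z) \<in> ?r" "(z, u) \<in> ?r" for u z
      proof (rule ccontr)
        assume "z \<noteq> u"
        then obtain w where w: "(u, w) \<in> ?r" "(w, u) \<in> ?r" "L w \<noteq> L u"
          using c3[of u z] uz by blast
        then have "w \<in> layered_class S f h u" "u \<in> layered_class S f h u"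
          by (auto simp: layered_preorder_iff layered_class_def)
        then show False
          using const w u by blast
      qed
      have "(x, y) \<in> ?r" "x \<noteq> y"
        using x y xy by (auto simp: layered_preorder_iff)
      moreover have "L x = L y"
        using const x y by (auto simp: layered_class_def)
      ultimately show False
        using c2 single by blast
    qed
    then show ?thesis
      using merged True by metis
  next
    case False
    then have "(p, q) \<in> ?r" "(q, p) \<in> ?r"
      using mixed outside pq by blast+
    then show ?thesis
      using c3 pq(1) rs by blast
  qed
  moreover have "(\<exists>z. z \<noteq> p \<and> (p, z) \<in> ?s \<and> (z, p) \<in> ?s) \<or> (\<exists>z. z \<noteq> q \<and> (q, z) \<in> ?s \<and> (z, q) \<in> ?s)"
    if pq: "(p, q) \<in> ?s" "p \<noteq> q" "L p = L q" for p q
  proof (cases "p \<in> ?X \<union> ?Y \<or> q \<in> ?X \<union> ?Y")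
    case True
    then show ?thesis
      using other merged by metis
  next
    case False
    then have "(p, q) \<in> ?r"
      using outside pq by blast
    then show ?thesis
      using c2 pq rs by blast
  qed
  ultimately show ?thesis
    using base rs unfolding collapses_def by blast
qed

text \<open>The induction along the contraction sequence also carries the layered form, which
  \<open>contract_edge_layered\<close> needs at each step.\<close>

lemma contraction_imp_collapses:
  assumes "preorder_contraction S s (layered_preorder S L (\<lambda>_. False))"
  shows "collapses S L (\<lambda>_. False) s"
proof -
  have "(edge_contraction S)\<^sup>*\<^sup>* (layered_preorder S L (\<lambda>_. False)) s"
    using assms by (simp add: preorder_contraction_def)
  then have "\<exists>f h. s = layered_preorder S f h \<and> collapses S L (\<lambda>_. False) s"
  proof (induction rule: rtranclp_induct)
    case base
    have "collapses S L (\<lambda>_. False) (layered_preorder S L (\<lambda>_. False))"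
      by (auto simp: collapses_def layered_preorder_iff)
    then show ?case by blast
  next
    case (step r s)
    then obtain f h where r: "r = layered_preorder S f h"
      and col: "collapses S L (\<lambda>_. False) (layered_preorder S f h)"
      by blast
    obtain G H where GH: "hasse_edge S r G H" "s = contract_edge r G H"
      using step.hyps(2) by (auto simp: edge_contraction_def)
    then obtain x y where xy: "x \<in> S" "y \<in> S" "f x < f y" "\<not> (\<exists>z\<in>S. f x < f z \<and> f z < f y)"
      and cls: "G = layered_class S f h x" "H = layered_class S f h y"
      unfolding r hasse_edge_layered by blast
    have "s = layered_preorder S (merged_layer S f h x y) (merged_hom h)"
      unfolding GH(2) r cls by (rule contract_edge_layered[OF xy])
    then show ?case
      using collapses_step[OF col xy] by metis
  qed
  then show ?thesis by blast
qed

text \<open>Induction on the number of pairs of \<open>s\<close> not yet reached. A general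
  \<open>h\<close> is allowed because a contraction creates a homogeneous layer, and the induction
  hypothesis is applied to the result. Once no class of \<open>s\<close> meets two layers, nothing
  is left to add.\<close>

lemma collapses_imp_contraction:
  assumes "finite S" "s \<subseteq> S \<times> S" "trans s" "collapses S f h s"
  shows "preorder_contraction S s (layered_preorder S f h)"
  using assms(4)
proof (induction "card (s - layered_preorder S f h)" arbitrary: f h rule: less_induct)
  case less
  let ?r = "layered_preorder S f h"
  have rs: "?r \<subseteq> s"
    and c2: "\<And>p q. (p, q) \<in> s \<Longrightarrow> p \<noteq> q \<Longrightarrow> f p = f q \<Longrightarrow>
        (\<exists>z. z \<noteq> p \<and> (p, z) \<in> s \<and> (z, p) \<in> s) \<or> (\<exists>z. z \<noteq> q \<and> (q, z) \<in> s \<and> (z, q) \<in> s)"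
    and c3: "\<And>p q. p \<noteq> q \<Longrightarrow> (p, q) \<in> s \<Longrightarrow> (q, p) \<in> s \<Longrightarrow>
        (f p = f q \<and> h (f p)) \<or> (\<exists>z. (p, z) \<in> s \<and> (z, p) \<in> s \<and> f z \<noteq> f p)"
    using less.prems unfolding collapses_def by blast+
  have tr: "(p, q) \<in> s" if "(p, z) \<in> s" "(z, q) \<in> s" for p z q
    using assms(3) that by (meson transD)
  have fin: "finite s"
    using assms(1,2) by (meson finite_SigmaI finite_subset)
  have S: "p \<in> S \<and> q \<in> S" if "(p, q) \<in> s" for p q
    using that assms(2) by blast
  show ?case
  proof (cases "\<exists>x y. (x, y) \<in> s \<and> (y, x) \<in> s \<and> f x < f y")
    case True
    \<comment> \<open>Among the pairs to be merged, one with the closest layers spans no occupied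
      layer: an element in between would be equivalent to \<open>x\<close> as well, at smaller
      distance.\<close>
    define d where "d = (LEAST d. \<exists>x y. (x, y) \<in> s \<and> (y, x) \<in> s \<and> f x < f y \<and> d = f y - f x)"
    have "\<exists>d x y. (x, y) \<in> s \<and> (y, x) \<in> s \<and> f x < f y \<and> d = f y - f x"
      using True by blast
    then have "\<exists>x y. (x, y) \<in> s \<and> (y, x) \<in> s \<and> f x < f y \<and> d = f y - f x"
      unfolding d_def by (rule LeastI_ex)
    then obtain x y where xy: "(x, y) \<in> s" "(y, x) \<in> s" "f x < f y" "d = f y - f x"
      by blast
    have min: "d \<le> f v - f u" if "(u, v) \<in> s" "(v, u) \<in> s" "f u < f v" for u v
      unfolding d_def by (rule Least_le) (use that in blast)
    have gap: "\<not> (\<exists>z\<in>S. f x < f z \<and> f z < f y)"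
    proof
      assume "\<exists>z\<in>S. f x < f z \<and> f z < f y"
      then obtain z where z: "z \<in> S" "f x < f z" "f z < f y" by blast
      then have "(x, z) \<in> s" "(z, y) \<in> s"
        using rs S[OF xy(1)] by (auto simp: layered_preorder_iff subset_iff)
      then have "d \<le> f z - f x"
        using min z(2) tr xy(2) by blast
      then show False
        using xy z by linarith
    qed
    have xS: "x \<in> S" and yS: "y \<in> S"
      using S xy(1) by auto
    let ?X = "layered_class S f h x" and ?Y = "layered_class S f h y"
    let ?f = "merged_layer S f h x y" and ?h = "merged_hom h"
    let ?r' = "layered_preorder S ?f ?h"
    have r': "contract_edge ?r ?X ?Y = ?r'"
      by (rule contract_edge_layered[OF xS yS xy(3) gap])
    have edge: "edge_contraction S ?r ?r'"
      unfolding edge_contraction_def hasse_edge_layered using xS yS xy(3) gap r' by blast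
    have X: "(x, z) \<in> s \<and> (z, x) \<in> s" if "z \<in> ?X" for z
      using that rs xS by (auto simp: layered_preorder_iff subset_iff layered_class_def)
    have Y: "(y, z) \<in> s \<and> (z, y) \<in> s" if "z \<in> ?Y" for z
      using that rs yS by (auto simp: layered_preorder_iff subset_iff layered_class_def)
    have XY: "(z, x) \<in> s \<and> (x, z) \<in> s" if "z \<in> ?X \<union> ?Y" for z
      using that X Y tr xy by blast
    have "?r \<union> ?Y \<times> ?X \<subseteq> s"
      using rs X Y tr xy by blast
    then have "(?r \<union> ?Y \<times> ?X)\<^sup>+ \<subseteq> s\<^sup>+"
      by (rule trancl_mono_subset)
    then have r's: "?r' \<subseteq> s"
      unfolding r'[symmetric] contract_edge_def using assms(3) by (simp add: trancl_id)
    have sub: "?r \<subseteq> ?r'"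
      unfolding r'[symmetric] contract_edge_def by auto
    have "(y, x) \<in> ?r'"
      unfolding r'[symmetric] contract_edge_def using xS yS by (auto simp: layered_class_def)
    moreover have "(y, x) \<notin> ?r"
      using xy(3) by (auto simp: layered_preorder_iff)
    ultimately have "s - ?r' \<subset> s - ?r"
      using sub xy(2) by blast
    then have smaller: "card (s - ?r') < card (s - ?r)"
      using fin by (intro psubset_card_mono) auto
    have ev: "2 * k \<noteq> 2 * f y - 1" for k
      using xy(3) by presburger
    \<comment> \<open>Doubling is injective, so outside the merged class equal new layers come from
      equal old ones.\<close>
    have layer: "f p = f q" if "?f p = ?f q" "p \<notin> ?X \<union> ?Y \<or> q \<notin> ?X \<union> ?Y" for p q
      using that ev ev[symmetric] by (auto simp: merged_layer_def split: if_splits)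
    have "(\<exists>z. z \<noteq> p \<and> (p, z) \<in> s \<and> (z, p) \<in> s) \<or> (\<exists>z. z \<noteq> q \<and> (q, z) \<in> s \<and> (z, q) \<in> s)"
      if pq: "(p, q) \<in> s" "p \<noteq> q" "?f p = ?f q" for p q
    proof (cases "p \<in> ?X \<union> ?Y \<and> q \<in> ?X \<union> ?Y")
      case True
      then show ?thesis
        using XY tr pq by blast
    next
      case False
      then have "f p = f q"
        using layer[OF pq(3)] by blast
      then show ?thesis
        by (rule c2[OF pq(1,2)])
    qed
    moreover have "(?f p = ?f q \<and> ?h (?f p)) \<or> (\<exists>z. (p, z) \<in> s \<and> (z, p) \<in> s \<and> ?f z \<noteq> ?f p)"
      if pq: "p \<noteq> q" "(p, q) \<in> s" "(q, p) \<in> s" for p q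
    proof (cases "p \<in> ?X \<union> ?Y")
      case p: True
      show ?thesis
      proof (cases "q \<in> ?X \<union> ?Y")
        case True
        then show ?thesis
          using p xy(3) by (auto simp: merged_layer_def merged_hom_def)
      next
        case False
        \<comment> \<open>The witness is \<open>q\<close> itself, which is equivalent to
          \<open>p\<close> in \<open>s\<close> but not on the merged layer.\<close>
        then have "?f q \<noteq> ?f p"
          using p ev[of "f q"] by (simp add: merged_layer_def)
        then show ?thesis
          using pq(2,3) by metis
      qed
    next
      case p: False
      from c3[OF pq] show ?thesis
      proof
        assume "f p = f q \<and> h (f p)"
        then have hom: "f p = f q" "h (f q)" by auto
        show ?thesis
        proof (cases "q \<in> ?X \<union> ?Y")
          case True
          then have "?f q \<noteq> ?f p"
            using p ev[of "f p"] by (simp add: merged_layer_def)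
          then show ?thesis
            using pq(2,3) by metis
        next
          case False
          then have "?f p = ?f q \<and> ?h (?f p)"
            using p hom by (simp add: merged_layer_def merged_hom_def)
          then show ?thesis ..
        qed
      next
        assume "\<exists>z. (p, z) \<in> s \<and> (z, p) \<in> s \<and> f z \<noteq> f p"
        then obtain z where z: "(p, z) \<in> s" "(z, p) \<in> s" "f z \<noteq> f p" by blast
        have "?f z \<noteq> ?f p"
          using layer[of z p] p z(3) by metis
        then show ?thesis
          using z(1,2) by metis
      qed
    qed
    ultimately have "collapses S ?f ?h s"
      using r's unfolding collapses_def by blast
    then have "preorder_contraction S s ?r'"
      using less.hyps smaller by blast
    then show ?thesis
      using edge by (simp add: preorder_contraction_def converse_rtranclp_into_rtranclp)
  next
    case False
    have flat: "f p = f q" if "(p, q) \<in> s" "(q, p) \<in> s" for p q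
      using False that by (metis linorder_neqE_nat)
    have triv: "f p = f q \<and> h (f p)" if "p \<noteq> q" "(p, q) \<in> s" "(q, p) \<in> s" for p q
      using c3[OF that] flat by metis
    \<comment> \<open>A pair against the order of \<open>f\<close> would be reversible, contrary to
      \<open>flat\<close>; a pair inside an antichain layer would by \<open>c2\<close> need a
      nontrivial class, which \<open>triv\<close> places on a homogeneous layer.\<close>
    have "s \<subseteq> ?r"
    proof
      fix e assume "e \<in> s"
      then obtain p q where e: "e = (p, q)" and pq: "(p, q) \<in> s" by (cases e) auto
      have "p = q \<or> f p < f q \<or> f p = f q \<and> h (f p)"
      proof (rule ccontr)
        assume neg: "\<not> ?thesis"
        have "f p = f q"
        proof (rule ccontr)
          assume "f p \<noteq> f q"
          then have "(q, p) \<in> ?r"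
            using neg S[OF pq] by (simp add: layered_preorder_iff)
          then show False
            using \<open>f p \<noteq> f q\<close> flat[OF pq] rs by blast
        qed
        moreover from this have "\<not> h (f p)" "\<not> h (f q)"
          using neg by auto
        ultimately show False
          using c2[OF pq] neg triv by metis
      qed
      then show "e \<in> ?r"
        using e S[OF pq] by (simp add: layered_preorder_iff)
    qed
    then show ?thesis
      using rs by (simp add: preorder_contraction_def)
  qed
qed

text \<open>The hypothesis excludes a homogeneous layer with one element, which is indistinguishable
  from a non-homogeneous one.\<close>

lemma contraction_layered_iff:
  assumes "finite S" and hom: "\<And>p. p \<in> S \<Longrightarrow> h (f p) \<Longrightarrow> \<exists>q\<in>S. q \<noteq> p \<and> f q = f p"
  shows "preorder_contraction S (layered_preorder S f h) (layered_preorder S L (\<lambda>_. False)) \<longleftrightarrow>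
    (\<forall>p\<in>S. \<forall>q\<in>S. L p < L q \<longrightarrow> f p < f q \<or> (f p = f q \<and> h (f p))) \<and>
    (\<forall>p\<in>S. \<forall>q\<in>S. f p < f q \<and> L p = L q \<longrightarrow> h (f p) \<or> h (f q)) \<and>
    (\<forall>p\<in>S. h (f p) \<longrightarrow> (\<exists>z\<in>S. f z = f p \<and> L z \<noteq> L p))"
    (is "_ \<longleftrightarrow> ?a \<and> ?b \<and> ?c")
proof -
  let ?s = "layered_preorder S f h"
  have "?s \<subseteq> S \<times> S"
    by (auto simp: layered_preorder_iff)
  then have "preorder_contraction S ?s (layered_preorder S L (\<lambda>_. False)) \<longleftrightarrow>
      collapses S L (\<lambda>_. False) ?s"
    using contraction_imp_collapses collapses_imp_contraction assms(1) trans_layered_preorder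
    by metis
  also have "\<dots> \<longleftrightarrow> ?a \<and> ?b \<and> ?c"
  proof -
    have eqv: "(p, z) \<in> ?s \<and> (z, p) \<in> ?s \<longleftrightarrow>
        p \<in> S \<and> z \<in> S \<and> (p = z \<or> f p = f z \<and> h (f p))" for p z
      by (auto simp: layered_preorder_iff)
    \<comment> \<open>By \<open>hom\<close> a homogeneous layer has a second element, so lying on
      one is the same as being merged with something else.\<close>
    have nontriv: "(\<exists>z. z \<noteq> p \<and> (p, z) \<in> ?s \<and> (z, p) \<in> ?s) \<longleftrightarrow> p \<in> S \<and> h (f p)" for p
      unfolding eqv using hom by metis
    have "layered_preorder S L (\<lambda>_. False) \<subseteq> ?s \<longleftrightarrow> ?a"
      by (auto simp: layered_preorder_iff subset_iff)
    moreover have "(\<forall>p q. (p, q) \<in> ?s \<and> p \<noteq> q \<and> L p = L q \<longrightarrow>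
        (\<exists>z. z \<noteq> p \<and> (p, z) \<in> ?s \<and> (z, p) \<in> ?s) \<or>
        (\<exists>z. z \<noteq> q \<and> (q, z) \<in> ?s \<and> (z, q) \<in> ?s)) \<longleftrightarrow> ?b"
      unfolding nontriv by (auto simp: layered_preorder_iff)
    moreover have "(\<forall>p q. p \<noteq> q \<and> (p, q) \<in> ?s \<and> (q, p) \<in> ?s \<longrightarrow>
        (L p = L q \<and> False) \<or> (\<exists>z. (p, z) \<in> ?s \<and> (z, p) \<in> ?s \<and> L z \<noteq> L p)) \<longleftrightarrow> ?c"
      (is "?l \<longleftrightarrow> _")
    proof
      assume l: ?l
      show ?c
      proof (intro ballI impI)
        fix p assume p: "p \<in> S" "h (f p)"
        then have "\<exists>z. z \<noteq> p \<and> (p, z) \<in> ?s \<and> (z, p) \<in> ?s"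
          unfolding nontriv by blast
        then obtain z where "(p, z) \<in> ?s \<and> (z, p) \<in> ?s" "L z \<noteq> L p"
          using l by metis
        then show "\<exists>z\<in>S. f z = f p \<and> L z \<noteq> L p"
          unfolding eqv by metis
      qed
    next
      assume c: ?c
      show ?l
      proof (intro allI impI disjI2)
        fix p q assume "p \<noteq> q \<and> (p, q) \<in> ?s \<and> (q, p) \<in> ?s"
        then have p: "p \<in> S" "h (f p)"
          using eqv[of p q] by blast+
        then obtain z where "z \<in> S" "f z = f p" "L z \<noteq> L p"
          using c by blast
        then have "(p, z) \<in> ?s \<and> (z, p) \<in> ?s" "L z \<noteq> L p"
          unfolding eqv using p by auto
        then show "\<exists>z. (p, z) \<in> ?s \<and> (z, p) \<in> ?s \<and> L z \<noteq> L p" by blast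
      qed
    qed
    ultimately show ?thesis
      unfolding collapses_def by (simp only:)
  qed
  finally show ?thesis .
qed

section \<open>Blocks as layers\<close>

text \<open>A list index, hence shifted: the values 0, 1 and \<open>j + 1\<close> stand for the
  blocks with index -1, 0 and \<open>j\<close>.\<close>

definition block_index :: "block list \<Rightarrow> nat \<Rightarrow> nat" where
  "block_index B x = (LEAST i. i < length B \<and> x \<in> elems (B ! i))"

lemma block_index:
  assumes "skewed_binary_partition n B" "x \<le> n"
  shows "block_index B x < length B" "x \<in> elems (B ! block_index B x)"
proof -
  have "x \<in> (\<Union>X \<in> set B. elems X)"
    using assms by (simp add: skewed_binary_partition_def)
  then have "\<exists>i. i < length B \<and> x \<in> elems (B ! i)"
    by (auto simp: in_set_conv_nth)
  then have "block_index B x < length B \<and> x \<in> elems (B ! block_index B x)"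
    unfolding block_index_def by (rule LeastI_ex)
  then show "block_index B x < length B" "x \<in> elems (B ! block_index B x)"
    by auto
qed

lemma elems_block:
  assumes "skewed_binary_partition n B" "i < length B"
  shows "elems (B ! i) = {x \<in> {0..n}. block_index B x = i}"
proof (intro set_eqI iffI)
  fix x assume x: "x \<in> elems (B ! i)"
  have "(\<Union>X \<in> set B. elems X) = {0..n}"
    using assms by (simp add: skewed_binary_partition_def)
  then have "x \<le> n"
    using x assms(2) nth_mem by fastforce
  moreover have "block_index B x = i"
  proof (rule ccontr)
    assume "block_index B x \<noteq> i"
    then have "elems (B ! block_index B x) \<inter> elems (B ! i) = {}"
      using assms block_index(1)[OF assms(1) \<open>x \<le> n\<close>] unfolding skewed_binary_partition_def by metis
    then show False
      using x block_index(2)[OF assms(1) \<open>x \<le> n\<close>] by blast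
  qed
  ultimately show "x \<in> {x \<in> {0..n}. block_index B x = i}" by simp
next
  fix x assume "x \<in> {x \<in> {0..n}. block_index B x = i}"
  then show "x \<in> elems (B ! i)"
    using block_index(2)[OF assms(1)] by auto
qed

lemma sbp_preorder_layered:
  assumes "skewed_binary_partition n B"
  shows "sbp_preorder n B = layered_preorder {0..n} (block_index B) (\<lambda>i. is_hom (B ! i))"
proof -
  have mem: "i < length B \<and> x \<in> elems (B ! i) \<longleftrightarrow> x \<le> n \<and> block_index B x = i" for i x
    using elems_block[OF assms] block_index[OF assms] by auto
  have "(\<exists>i j. i < j \<and> j < length B \<and> p \<in> elems (B ! i) \<and> q \<in> elems (B ! j)) \<longleftrightarrow>
      block_index B p < block_index B q" if "p \<le> n" "q \<le> n" for p q
    using that mem[of _ p] mem[of _ q] by (metis less_trans)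
  moreover have "(\<exists>i<length B. is_hom (B ! i) \<and> p \<in> elems (B ! i) \<and> q \<in> elems (B ! i)) \<longleftrightarrow>
      block_index B p = block_index B q \<and> is_hom (B ! block_index B p)" if "p \<le> n" "q \<le> n" for p q
    using that mem[of _ p] mem[of _ q] by metis
  ultimately show ?thesis
    unfolding sbp_preorder_def layered_preorder_def by (simp cong: conj_cong)
qed

lemma sbp_finite_elems:
  assumes "skewed_binary_partition n B" "i < length B"
  shows "finite (elems (B ! i))"
  using elems_block[OF assms] by simp

text \<open>Supplies the hypothesis \<open>hom\<close> of \<open>contraction_layered_iff\<close>:
  the first block is never homogeneous, and later singletons are not either.\<close>

lemma hom_block_nontrivial:
  assumes "skewed_binary_partition n B" "p \<le> n" "is_hom (B ! block_index B p)"
  shows "\<exists>q\<in>{0..n}. q \<noteq> p \<and> block_index B q = block_index B p"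
proof (rule ccontr)
  let ?i = "block_index B p"
  assume "\<not> ?thesis"
  then have "elems (B ! ?i) = {p}"
    using elems_block[OF assms(1) block_index(1)[OF assms(1,2)]] assms(2) by auto
  moreover have "?i \<noteq> 0"
    using assms by (auto simp: skewed_binary_partition_def intro: ccontr)
  ultimately show False
    using assms block_index(1)[OF assms(1,2)] unfolding skewed_binary_partition_def
    by (metis One_nat_def card.empty card.insert empty_iff finite.emptyI less_one not_le)
qed

section \<open>The types in Omega\<close>

lemma msum_Suc: "msum m (Suc i) = msum m i + m ! Suc i"
  by (simp add: msum_def)

lemma msum_0: "msum m 0 = m ! 0"
  by (simp add: msum_def)

lemma msum_split: "msum m g = m ! 0 + (\<Sum>t = 1..g. m ! t)"
  by (induction g) (simp_all add: msum_0 msum_Suc)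

lemma msum_strict_mono:
  assumes "multiplicity_vector n m" "i < j" "j < length m"
  shows "msum m i < msum m j"
  using assms(2,3)
proof (induction j)
  case (Suc j)
  then have "m ! Suc j \<ge> 1"
    using assms(1) by (simp add: multiplicity_vector_def)
  then show ?case
    using Suc by (cases "i = j") (auto simp: msum_Suc)
qed simp

lemma msum_mono: "i \<le> j \<Longrightarrow> msum m i \<le> msum m j"
  unfolding msum_def by (rule sum_mono2) auto

lemma msum_last:
  assumes "multiplicity_vector n m"
  shows "msum m (length m - 1) = n"
proof -
  have "sum_list m = (\<Sum>t<length m. m ! t)"
    by (simp add: sum_list_sum_nth lessThan_atLeast0)
  moreover have "{..length m - 1} = {..<length m}"
    using assms by (auto simp: multiplicity_vector_def)
  ultimately show ?thesis
    using assms by (simp add: msum_def multiplicity_vector_def)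
qed

lemma drop_conv_map_nth: "drop k m = map ((!) m) [k..<length m]"
  by (metis drop_map drop_upt map_nth add_0)

text \<open>The parameter \<open>K\<close> is the first entry of a type \<open>a\<^sub>i\<close>: \<open>K = m\<^sub>0 + i\<close>. The multiplicities
  which are exhausted by \<open>K\<close> contribute no block.\<close>

definition level_type :: "nat list \<Rightarrow> nat \<Rightarrow> type_entry list" where
  "level_type m K =
     Plain K # (if K = m ! 0 \<and> 0 < K then Plain 0 else Circ 0) #
     map (\<lambda>i. Plain (msum m i - max (msum m (i - 1)) K))
       (filter (\<lambda>i. K < msum m i) [1..<length m])"

text \<open>As \<open>msum m\<close> is monotone, the surviving multiplicities form a final segment;
  \<open>g = length m\<close> covers the case that all are exhausted.\<close>

lemma filter_upt_from:
  assumes "1 \<le> g" "g \<le> length m" "msum m (g - 1) \<le> K" "g < length m \<Longrightarrow> K < msum m g"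
  shows "filter (\<lambda>i. K < msum m i) [1..<length m] = [g..<length m]"
proof -
  have "[1..<length m] = [1..<g] @ [g..<length m]"
    using assms(1,2) by (metis le_add_diff_inverse upt_add_eq_append)
  moreover have "filter (\<lambda>i. K < msum m i) [1..<g] = []"
  proof -
    have "msum m i \<le> K" if "i < g" for i
      using that assms(3) msum_mono[of i "g - 1" m] by linarith
    then show ?thesis
      by (auto simp: filter_empty_conv not_less)
  qed
  moreover have "filter (\<lambda>i. K < msum m i) [g..<length m] = [g..<length m]"
  proof -
    have "K < msum m i" if "g \<le> i" "i < length m" for i
      using that assms(4) msum_mono[of g i m] by linarith
    then show ?thesis
      by (auto simp: filter_id_conv)
  qed
  ultimately show ?thesis by simp
qed

text \<open>\<open>K\<close> cuts through the multiplicity with index \<open>g\<close>, of which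
  \<open>msum m g - K\<close> is left; the later ones are untouched.\<close>

lemma level_type_inside:
  assumes "1 \<le> g" "g < length m" "msum m (g - 1) \<le> K" "K < msum m g"
  shows "level_type m K = Plain K # (if K = m ! 0 \<and> 0 < K then Plain 0 else Circ 0) #
    Plain (msum m g - K) # map Plain (drop (g + 1) m)"
proof -
  have "filter (\<lambda>i. K < msum m i) [1..<length m] = g # [g + 1..<length m]"
    using filter_upt_from[of g m K] assms by (simp add: upt_conv_Cons)
  moreover have "map (\<lambda>i. Plain (msum m i - max (msum m (i - 1)) K)) [g + 1..<length m] =
      map Plain (drop (g + 1) m)"
  proof -
    have "msum m i - max (msum m (i - 1)) K = m ! i" if "g + 1 \<le> i" for i
    proof -
      have "K \<le> msum m (i - 1)"
        using assms(4) that msum_mono[of g "i - 1" m] by linarith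
      moreover have "msum m i = msum m (i - 1) + m ! i"
        using msum_Suc[of m "i - 1"] that by simp
      ultimately show ?thesis by simp
    qed
    then show ?thesis
      unfolding drop_conv_map_nth by (simp add: o_def)
  qed
  ultimately show ?thesis
    using assms(3) by (simp add: level_type_def max_def)
qed

text \<open>The three groups are the cases \<open>K = m ! 0\<close>, \<open>m ! 0 < K < n\<close>
  and \<open>K = n\<close>. Since \<open>m ! 0 < n\<close>, the last one always carries
  \<open>Circ 0\<close>.\<close>

lemma Omega_eq:
  assumes m: "multiplicity_vector n m"
  shows "Omega m = level_type m ` {m ! 0..n}"
proof -
  have len: "length m \<ge> 2" and n: "sum_list m = n"
    using m by (auto simp: multiplicity_vector_def)
  have m0: "m ! 0 < n"
    using msum_strict_mono[OF m, of 0 "length m - 1"] msum_last[OF m] len by (simp add: msum_0)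
  have first: "level_type m (m ! 0) =
      Plain (m ! 0) # (if m ! 0 > 0 then Plain 0 else Circ 0) # map Plain (drop 1 m)"
  proof -
    have "msum m 0 < msum m 1"
      using msum_strict_mono[OF m] len by simp
    moreover have "drop 1 m = m ! 1 # drop 2 m"
      using len by (metis Cons_nth_drop_Suc One_nat_def Suc_1 Suc_le_lessD)
    ultimately show ?thesis
      using level_type_inside[of 1 m "m ! 0"] len msum_Suc[of m 0] by (simp add: msum_0 numeral_2_eq_2)
  qed
  have final: "level_type m n = [Plain n, Circ 0]"
  proof -
    have "filter (\<lambda>i. n < msum m i) [1..<length m] = []"
      using filter_upt_from[of "length m" m n] len msum_last[OF m] by simp
    then show ?thesis
      using m0 by (simp add: level_type_def)
  qed
  have total: "(\<Sum>t = 1..<length m. m ! t) = n - m ! 0"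
  proof -
    have "{1..<length m} = {1..length m - 1}"
      using len by auto
    then show ?thesis
      using msum_split[of m "length m - 1"] msum_last[OF m] by simp
  qed
  have below: "(\<Sum>t = 1..<g. m ! t) = msum m (g - 1) - m ! 0" if "1 \<le> g" for g
  proof -
    have "{1..<g} = {1..g - 1}"
      using that by auto
    then show ?thesis
      using msum_split[of m "g - 1"] by simp
  qed
  have upto: "(\<Sum>t = 1..g. m ! t) = msum m g - m ! 0" for g
    using msum_split[of m g] by simp
  have ge: "m ! 0 \<le> msum m g" for g
    using msum_split[of m g] by simp
  have middle: "level_type m (m ! 0 + i) = Plain (m ! 0 + i) # Circ 0 #
      Plain ((\<Sum>t = 1..g. m ! t) - i) # map Plain (drop (g + 1) m)"
    if "1 \<le> i" "1 \<le> g" "g < length m" "(\<Sum>t = 1..<g. m ! t) \<le> i" "i < (\<Sum>t = 1..g. m ! t)" for i g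
  proof -
    have "msum m (g - 1) \<le> m ! 0 + i" "m ! 0 + i < msum m g"
      using that below upto ge[of g] ge[of "g - 1"] by auto
    then show ?thesis
      using level_type_inside[of g m "m ! 0 + i"] that(1,2,3) upto by simp
  qed
  show ?thesis
  proof
    show "Omega m \<subseteq> level_type m ` {m ! 0..n}"
    proof
      fix \<tau> assume "\<tau> \<in> Omega m"
      then consider "\<tau> = level_type m (m ! 0)" | "\<tau> = level_type m n"
        | i g where "\<tau> = Plain (m ! 0 + i) # Circ 0 #
            Plain ((\<Sum>t = 1..g. m ! t) - i) # map Plain (drop (g + 1) m)"
          "1 \<le> i" "i < n - m ! 0" "1 \<le> g" "g < length m" "(\<Sum>t = 1..<g. m ! t) \<le> i"
          "i < (\<Sum>t = 1..g. m ! t)"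
        unfolding Omega_def n first final total by (elim UnE CollectE exE conjE) auto
      then show "\<tau> \<in> level_type m ` {m ! 0..n}"
      proof cases
        case 3
        then have "\<tau> = level_type m (m ! 0 + i)"
          using middle[of i g] by simp
        then show ?thesis
          by (rule image_eqI) (use 3 in auto)
      qed (use m0 in auto)
    qed
    show "level_type m ` {m ! 0..n} \<subseteq> Omega m"
    proof
      fix \<tau> assume "\<tau> \<in> level_type m ` {m ! 0..n}"
      then obtain K where K: "\<tau> = level_type m K" "m ! 0 \<le> K" "K \<le> n" by auto
      consider "K = m ! 0" | "K = n" | "m ! 0 < K" "K < n"
        using K by linarith
      then show "\<tau> \<in> Omega m"
      proof cases
        case 3
        \<comment> \<open>The index required by the middle group: minimality gives
          \<open>msum m (g - 1) \<le> K < msum m g\<close>.\<close>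
        define g where "g = (LEAST g. K < msum m g)"
        have ex: "K < msum m (length m - 1)"
          using msum_last[OF m] 3 by simp
        have Kg: "K < msum m g"
          unfolding g_def by (rule LeastI, rule ex)
        have "g \<le> length m - 1"
          unfolding g_def by (rule Least_le, rule ex)
        then have gl: "g < length m"
          using len by simp
        have g1: "1 \<le> g"
          using Kg K(2) msum_0[of m] by (cases g) auto
        have gK: "msum m (g - 1) \<le> K"
          using not_less_Least[of "g - 1" "\<lambda>g. K < msum m g"] g1 by (simp add: g_def[symmetric])
        define i where "i = K - m ! 0"
        have i: "1 \<le> i" "i < (\<Sum>t = 1..<length m. m ! t)" "(\<Sum>t = 1..<g. m ! t) \<le> i"
          "i < (\<Sum>t = 1..g. m ! t)" "K = m ! 0 + i"
          using 3 Kg gK below[OF g1] upto total ge[of g] ge[of "g - 1"] by (auto simp: i_def)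
        then show ?thesis
          unfolding Omega_def using middle[OF i(1) g1 gl i(3,4)] g1 gl K(1) by blast
      qed (use K(1) first final n in \<open>simp_all add: Omega_def\<close>)
    qed
  qed
qed

section \<open>Level functions\<close>

text \<open>Levels of the elements of a partition of type \<open>level_type m K\<close>: level \<open>0\<close> for index \<open>-1\<close>, level \<open>1\<close> for
  index \<open>0\<close>, and level \<open>i + 1\<close> for what is left of the multiplicity \<open>m\<^sub>i\<close>. Levels may be empty.\<close>

definition level_function :: "nat list \<Rightarrow> nat \<Rightarrow> (nat \<Rightarrow> nat) \<Rightarrow> bool" where
  "level_function m K L \<longleftrightarrow>
     (if K = m ! 0 \<and> 0 < K then L 0 = 0 \<and> (\<forall>x\<le>sum_list m. L x \<noteq> 1)
      else \<forall>x\<le>sum_list m. L x = 1 \<longleftrightarrow> x = 0) \<and>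
     (\<forall>x\<le>sum_list m. L x \<le> length m) \<and>
     (\<forall>i<length m. card {x \<in> {0..sum_list m}. L x \<le> Suc i} = Suc (max (msum m i) K))"

text \<open>The level of each list position in a partition of type \<open>level_type m K\<close>;
  exhausted multiplicities are skipped, so positions and levels can differ.\<close>

definition level_list :: "nat list \<Rightarrow> nat \<Rightarrow> nat list" where
  "level_list m K = [0, 1] @ map Suc (filter (\<lambda>i. K < msum m i) [1..<length m])"

lemma sorted_level_list: "sorted_wrt (<) (level_list m K)"
  by (auto simp: level_list_def sorted_wrt_map intro!: sorted_wrt_filter)

lemma level_list_less_iff:
  assumes "i < length (level_list m K)" "j < length (level_list m K)"
  shows "level_list m K ! i < level_list m K ! j \<longleftrightarrow> i < j"
  using assms sorted_wrt_nth_less[OF sorted_level_list, of _ _ m K]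
  by (metis less_asym linorder_neqE_nat less_irrefl)

section \<open>Entries of the types and the levels of their positions\<close>

lemma length_sbp_type: "length B \<ge> 2 \<Longrightarrow> length (sbp_type B) = length B"
  by (simp add: sbp_type_def)

lemma length_level_type: "length (level_type m K) = length (level_list m K)"
  by (simp add: level_type_def level_list_def)

lemma sbp_type_nth:
  assumes "2 \<le> i" "i < length B"
  shows "sbp_type B ! i =
    (if is_hom (B ! i) then Star (card (elems (B ! i))) else Plain (card (elems (B ! i))))"
proof -
  obtain k where "i = Suc (Suc k)"
    using assms(1) by (metis add_2_eq_Suc le_Suc_ex)
  then show ?thesis
    using assms(2) by (simp add: sbp_type_def)
qed

lemma sbp_type_0:
  "sbp_type B ! 0 = Plain (if 0 \<in> elems (B ! 1) then card (elems (B ! 0)) else card (elems (B ! 0)) - 1)"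
  by (simp add: sbp_type_def)

lemma sbp_type_1:
  "sbp_type B ! 1 = (if 0 \<in> elems (B ! 1) then Circ (card (elems (B ! 1)) - 1) else Plain 0)"
  by (simp add: sbp_type_def)

text \<open>A level \<open>c \<ge> 2\<close> belongs to the multiplicity with index
  \<open>c - 1\<close>, and \<open>c - 2\<close> is the index before it.\<close>

lemma level_type_nth:
  assumes "2 \<le> i" "i < length (level_list m K)"
  shows "level_type m K ! i = Plain (msum m (level_list m K ! i - 1) -
    max (msum m (level_list m K ! i - 2)) K)"
proof -
  obtain k where "i = Suc (Suc k)"
    using assms(1) by (metis add_2_eq_Suc le_Suc_ex)
  then show ?thesis
    using assms(2) by (simp add: level_type_def level_list_def)
qed

lemma level_type_0: "level_type m K ! 0 = Plain K"
  and level_type_1: "level_type m K ! 1 = (if K = m ! 0 \<and> 0 < K then Plain 0 else Circ 0)"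
  by (simp_all add: level_type_def)

lemma level_list_nth_0: "level_list m K ! 0 = 0"
  and level_list_nth_1: "level_list m K ! 1 = 1"
  and length_level_list_ge: "length (level_list m K) \<ge> 2"
  by (simp_all add: level_list_def)

lemma set_level_list:
  "c \<in> set (level_list m K) \<longleftrightarrow> c \<le> 1 \<or> (c - 1 < length m \<and> K < msum m (c - 1))"
  by (cases c) (auto simp: level_list_def image_iff)

text \<open>Every occupied block of \<open>A\<close> turns out to be non-homogeneous, so
  \<open>L\<close> only renumbers positions by the strictly increasing
  \<open>level_list\<close>.\<close>

lemma level_function_of_partition:
  assumes m: "multiplicity_vector n m" and A: "skewed_binary_partition n A"
    and type: "sbp_type A = level_type m K" and K: "m ! 0 \<le> K" "K \<le> n"
  shows "\<exists>L. level_function m K L \<and>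
    sbp_preorder n A = layered_preorder {0..n} L (\<lambda>_. False)"
proof -
  let ?J = "level_list m K"
  define L where "L x = ?J ! block_index A x" for x
  have n: "sum_list m = n" and lm: "length m \<ge> 2"
    using m by (auto simp: multiplicity_vector_def)
  have lenA: "length A \<ge> 2"
    using A by (simp add: skewed_binary_partition_def)
  then have len: "length A = length ?J"
    using type length_sbp_type length_level_type by metis
  have idx: "block_index A x < length ?J" if "x \<le> n" for x
    using block_index[OF A that] len by simp
  have level: "{x \<in> {0..n}. L x = ?J ! i} = elems (A ! i)" if "i < length ?J" for i
  proof -
    have "?J ! block_index A x = ?J ! i \<longleftrightarrow> block_index A x = i" if "x \<le> n" for x
      using level_list_less_iff[OF idx[OF that] \<open>i < length ?J\<close>]
        level_list_less_iff[OF \<open>i < length ?J\<close> idx[OF that]]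
      by (metis linorder_neqE_nat less_irrefl)
    then show ?thesis
      using elems_block[OF A, of i] that len by (auto simp: L_def)
  qed
  have J: "0 < length ?J" "1 < length ?J"
    using length_level_list_ge[of m K] by linarith+
  have level0: "{x \<in> {0..n}. L x = 0} = elems (A ! 0)"
    using level[OF J(1)] by (simp only: level_list_nth_0)
  have level1: "{x \<in> {0..n}. L x = 1} = elems (A ! 1)"
    using level[OF J(2)] by (simp only: level_list_nth_1)
  have zero: "0 \<in> elems (A ! 0) \<union> elems (A ! 1)"
    and zero0: "0 \<in> elems (A ! 0) \<Longrightarrow> card (elems (A ! 0)) \<ge> 2 \<and> elems (A ! 1) = {}"
    and single: "\<And>i. 1 \<le> i \<Longrightarrow> i < length A \<Longrightarrow> card (elems (A ! i)) = 1 \<Longrightarrow> \<not> is_hom (A ! i)"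
    and nonhom0: "\<not> is_hom (A ! 0)"
    using A by (auto simp: skewed_binary_partition_def)
  have type0: "Plain K = Plain (if 0 \<in> elems (A ! 1) then card (elems (A ! 0)) else card (elems (A ! 0)) - 1)"
    using sbp_type_0[of A] type level_type_0 by metis
  have type1: "(if K = m ! 0 \<and> 0 < K then Plain 0 else Circ 0) =
      (if 0 \<in> elems (A ! 1) then Circ (card (elems (A ! 1)) - 1) else Plain 0)"
    using sbp_type_1[of A] type level_type_1 by metis
  have fin: "finite (elems (A ! i))" if "i < length A" for i
    using sbp_finite_elems[OF A that] .
  \<comment> \<open>An undecorated 0 as second entry puts \<open>0\<close> into the first block,
    whose entry \<open>K\<close> does not count it; hence \<open>Suc K\<close>.\<close>
  have case1: "0 \<in> elems (A ! 0) \<and> elems (A ! 1) = {} \<and> card (elems (A ! 0)) = Suc K"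
    if "K = m ! 0 \<and> 0 < K"
  proof -
    have "0 \<notin> elems (A ! 1)"
      using type1 that by (auto split: if_splits)
    then show ?thesis
      using zero zero0 type0 by auto
  qed
  \<comment> \<open>\<open>Circ 0\<close> makes \<open>{0}\<close> a block of its own, and
    \<open>K\<close> counts the whole first block.\<close>
  have case2: "elems (A ! 1) = {0} \<and> card (elems (A ! 0)) = K" if "\<not> (K = m ! 0 \<and> 0 < K)"
  proof -
    have mem: "0 \<in> elems (A ! 1)" and "card (elems (A ! 1)) - 1 = 0"
      using type1 that by (auto split: if_splits)
    then have "card (elems (A ! 1)) = 1"
      using fin[of 1] lenA by (metis card_0_eq diff_is_0_eq empty_iff le_antisym less_one
          not_less One_nat_def Suc_1 Suc_le_lessD)
    then show ?thesis
      using mem type0 by (auto simp: card_1_singleton_iff)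
  qed
  \<comment> \<open>The first block by definition, the second as a singleton, the others because
    their entries in \<open>level_type\<close> are \<open>Plain\<close>.\<close>
  have nonhom: "\<not> is_hom (A ! block_index A x)" if "x \<le> n" for x
  proof -
    have i: "block_index A x < length A" "x \<in> elems (A ! block_index A x)"
      using block_index[OF A that] .
    consider "block_index A x = 0" | "block_index A x = 1" | "2 \<le> block_index A x"
      by linarith
    then show ?thesis
    proof cases
      case 1
      then show ?thesis
        using nonhom0 by simp
    next
      case 2
      then have "card (elems (A ! 1)) = 1"
        using i case1 case2 by (cases "K = m ! 0 \<and> 0 < K") auto
      then show ?thesis
        using single[of 1] 2 i by simp
    next
      case 3
      then have "is_Plain (sbp_type A ! block_index A x)"
        using level_type_nth[OF 3, of m K] i len type by simp
      then show ?thesis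
        using sbp_type_nth[OF 3 i(1)] by (auto split: if_splits)
    qed
  qed
  have "block_index A p < block_index A q \<longleftrightarrow> L p < L q" if "p \<le> n" "q \<le> n" for p q
    using level_list_less_iff[OF idx idx] that by (simp add: L_def)
  then have "layered_preorder {0..n} (block_index A) (\<lambda>i. is_hom (A ! i)) =
      layered_preorder {0..n} L (\<lambda>_. False)"
    unfolding layered_preorder_def by (simp add: nonhom cong: conj_cong)
  then have preorder: "sbp_preorder n A = layered_preorder {0..n} L (\<lambda>_. False)"
    using sbp_preorder_layered[OF A] by simp
  \<comment> \<open>The outer \<open>Suc\<close> counts the element \<open>0\<close>, which no entry
    of a type counts.\<close>
  have count: "card {x \<in> {0..n}. L x \<le> Suc i} = Suc (max (msum m i) K)" if "i < length m" for i
    using that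
  proof (induction i)
    case 0
    have "{x \<in> {0..n}. L x \<le> Suc 0} = elems (A ! 0) \<union> elems (A ! 1)"
      unfolding level0[symmetric] level1[symmetric] by auto
    moreover have "card (elems (A ! 0) \<union> elems (A ! 1)) = Suc K"
    proof (cases "K = m ! 0 \<and> 0 < K")
      case True
      then show ?thesis
        using case1 by simp
    next
      case False
      moreover have "0 \<notin> elems (A ! 0)"
        using zero0 case2[OF False] by auto
      moreover have "finite (elems (A ! 0))"
        by (rule fin) (use lenA in linarith)
      ultimately show ?thesis
        using case2 by simp
    qed
    ultimately show ?case
      using K by (simp add: msum_0 max_def)
  next
    case (Suc i)
    have "card {x \<in> {0..n}. L x = Suc (Suc i)} = msum m (Suc i) - max (msum m i) K"
    proof (cases "Suc (Suc i) \<in> set ?J")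
      case True
      then obtain k where k: "k < length ?J" "?J ! k = Suc (Suc i)"
        by (auto simp: in_set_conv_nth)
      have k2: "2 \<le> k"
        using k level_list_nth_0[of m K] level_list_nth_1[of m K]
        by (cases k; cases "k - 1") auto
      have "sbp_type A ! k = Plain (msum m (Suc i) - max (msum m i) K)"
        using level_type_nth[OF k2 k(1)] k(2) type by simp
      then have "card (elems (A ! k)) = msum m (Suc i) - max (msum m i) K"
        using sbp_type_nth[OF k2, of A] k len by (auto split: if_splits)
      then show ?thesis
        using level[OF k(1)] k(2) by simp
    next
      case False
      have "L x \<in> set ?J" if "x \<le> n" for x
        using idx[OF that] by (simp add: L_def)
      then have empty: "{x \<in> {0..n}. L x = Suc (Suc i)} = {}"
        using False by (metis (mono_tags, lifting) atLeastAtMost_iff empty_Collect_eq)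
      \<comment> \<open>An exhausted multiplicity: the level is empty, and the truncated subtraction
        gives 0 too.\<close>
      have "msum m (Suc i) \<le> K"
        using False Suc.prems by (auto simp: set_level_list)
      then show ?thesis
        unfolding empty by simp
    qed
    moreover have "{x \<in> {0..n}. L x \<le> Suc (Suc i)} =
        {x \<in> {0..n}. L x \<le> Suc i} \<union> {x \<in> {0..n}. L x = Suc (Suc i)}"
      by auto
    moreover have "card ({x \<in> {0..n}. L x \<le> Suc i} \<union> {x \<in> {0..n}. L x = Suc (Suc i)}) =
        card {x \<in> {0..n}. L x \<le> Suc i} + card {x \<in> {0..n}. L x = Suc (Suc i)}"
      by (rule card_Un_disjoint) auto
    moreover have "msum m i \<le> msum m (Suc i)"
      by (rule msum_mono) simp
    ultimately show ?case
      using Suc by (simp add: max_def)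
  qed
  have bound: "L x \<le> length m" if "x \<le> n" for x
  proof -
    have "L x \<in> set ?J"
      using idx[OF that] by (simp add: L_def)
    then have "L x \<le> 1 \<or> L x - 1 < length m"
      unfolding set_level_list by blast
    then show ?thesis
      using lm by linarith
  qed
  have "if K = m ! 0 \<and> 0 < K then L 0 = 0 \<and> (\<forall>x\<le>n. L x \<noteq> 1) else \<forall>x\<le>n. L x = 1 \<longleftrightarrow> x = 0"
  proof (cases "K = m ! 0 \<and> 0 < K")
    case True
    have "0 \<in> {x \<in> {0..n}. L x = 0}" "{x \<in> {0..n}. L x = 1} = {}"
      using case1[OF True] unfolding level0 level1 by blast+
    then show ?thesis
      using True by auto
  next
    case False
    have "{x \<in> {0..n}. L x = 1} = {0}"
      using case2[OF False] unfolding level1 by blast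
    then have "L x = 1 \<longleftrightarrow> x = 0" if "x \<le> n" for x
      using that by (auto simp: set_eq_iff)
    then show ?thesis
      using False by auto
  qed
  then have "level_function m K L"
    using count bound unfolding level_function_def n by simp
  then show ?thesis
    using preorder by blast
qed

text \<open>The level sets, listed in increasing order and all taken as antichains, form the
  partition. Level 1 is the only one from position 1 on that may be empty, as the second block
  may.\<close>

lemma partition_of_level_function:
  assumes m: "multiplicity_vector n m" and L: "level_function m K L"
    and K: "m ! 0 \<le> K" "K \<le> n"
  shows "\<exists>A. skewed_binary_partition n A \<and> sbp_type A = level_type m K \<and>
    sbp_preorder n A = layered_preorder {0..n} L (\<lambda>_. False)"
proof -
  let ?J = "level_list m K"
  define A where "A = map (\<lambda>c. Nonhom {x \<in> {0..n}. L x = c}) ?J"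
  have n: "sum_list m = n" and lm: "length m \<ge> 2"
    using m by (auto simp: multiplicity_vector_def)
  have len: "length A = length ?J"
    by (simp add: A_def)
  have lenA: "length A \<ge> 2"
    using length_level_list_ge[of m K] len by simp
  have nth: "A ! i = Nonhom {x \<in> {0..n}. L x = ?J ! i}" if "i < length A" for i
    using that by (simp add: A_def)
  have A0: "A ! 0 = Nonhom {x \<in> {0..n}. L x = 0}" and A1: "A ! 1 = Nonhom {x \<in> {0..n}. L x = 1}"
    by (simp_all add: A_def level_list_def)
  have start: "if K = m ! 0 \<and> 0 < K then L 0 = 0 \<and> (\<forall>x\<le>n. L x \<noteq> 1) else \<forall>x\<le>n. L x = 1 \<longleftrightarrow> x = 0"
    and bound: "\<And>x. x \<le> n \<Longrightarrow> L x \<le> length m"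
    and count: "\<And>i. i < length m \<Longrightarrow> card {x \<in> {0..n}. L x \<le> Suc i} = Suc (max (msum m i) K)"
    using L unfolding level_function_def n by blast+
  have exact: "card {x \<in> {0..n}. L x = Suc (Suc i)} = msum m (Suc i) - max (msum m i) K"
    if "Suc i < length m" for i
  proof -
    have "{x \<in> {0..n}. L x \<le> Suc (Suc i)} =
        {x \<in> {0..n}. L x \<le> Suc i} \<union> {x \<in> {0..n}. L x = Suc (Suc i)}"
      by auto
    moreover have "card ({x \<in> {0..n}. L x \<le> Suc i} \<union> {x \<in> {0..n}. L x = Suc (Suc i)}) =
        card {x \<in> {0..n}. L x \<le> Suc i} + card {x \<in> {0..n}. L x = Suc (Suc i)}"
      by (rule card_Un_disjoint) auto
    moreover have "msum m i \<le> msum m (Suc i)"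
      by (rule msum_mono) simp
    ultimately show ?thesis
      using count[of i] count[of "Suc i"] that by (simp add: max_def split: if_splits)
  qed
  have low: "card {x \<in> {0..n}. L x \<le> 1} = Suc K"
  proof -
    have "0 < length m"
      using lm by linarith
    then show ?thesis
      using count K(1) by (simp add: msum_0 max_def)
  qed
  \<comment> \<open>An occupied level above 1 has positive size, which by \<open>exact\<close> rules
    out exhausted multiplicities.\<close>
  have inJ: "L x \<in> set ?J" if "x \<le> n" for x
  proof (cases "L x \<le> 1")
    case True
    then show ?thesis
      by (simp add: set_level_list)
  next
    case False
    then obtain i where i: "L x = Suc (Suc i)"
      by (metis One_nat_def Suc_le_D not_less_eq_eq)
    have im: "Suc i < length m"
      using bound[OF that] i by simp
    have "{x \<in> {0..n}. L x = Suc (Suc i)} \<noteq> {}"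
      using i that by auto
    then have "card {x \<in> {0..n}. L x = Suc (Suc i)} > 0"
      by (simp add: card_gt_0_iff)
    then have "K < msum m (Suc i)"
      unfolding exact[OF im] by linarith
    then show ?thesis
      using i im by (simp add: set_level_list)
  qed
  have inj: "?J ! i = ?J ! j \<longleftrightarrow> i = j" if "i < length A" "j < length A" for i j
    using level_list_less_iff[of i m K j] level_list_less_iff[of j m K i] that len
    by (metis linorder_neqE_nat less_irrefl)
  have upper: "\<exists>k. ?J ! i = Suc (Suc k) \<and> Suc k < length m \<and> K < msum m (Suc k)"
    if "2 \<le> i" "i < length A" for i
  proof -
    have "1 < ?J ! i"
      using level_list_less_iff[of 1 m K i] that len by (simp add: level_list_nth_1[simplified])
    then obtain k where "?J ! i = Suc (Suc k)"
      by (metis One_nat_def Suc_le_D not_less_eq_eq less_imp_le not_le)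
    moreover have "?J ! i \<in> set ?J"
      using that len by simp
    ultimately show ?thesis
      by (auto simp: set_level_list)
  qed
  have union: "(\<Union>X \<in> set A. elems X) = {0..n}"
    using inJ by (auto simp: A_def)
  have zero_one: "{x \<in> {0..n}. L x = 1} = (if K = m ! 0 \<and> 0 < K then {} else {0})"
    and zero_zero: "L 0 = 0 \<longleftrightarrow> K = m ! 0 \<and> 0 < K"
    using start by (cases "K = m ! 0 \<and> 0 < K"; force)+
  have split: "{x \<in> {0..n}. L x \<le> 1} = {x \<in> {0..n}. L x = 0} \<union> {x \<in> {0..n}. L x = 1}"
    by auto
  have "card {x \<in> {0..n}. L x \<le> 1} = card {x \<in> {0..n}. L x = 0} + card {x \<in> {0..n}. L x = 1}"
    unfolding split by (rule card_Un_disjoint) auto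
  \<comment> \<open>Levels 0 and 1 together have \<open>Suc K\<close> elements, and \<open>0\<close>
    is either on level 0 or all of level 1.\<close>
  then have card_zero: "card {x \<in> {0..n}. L x = 0} = (if K = m ! 0 \<and> 0 < K then Suc K else K)"
    using low unfolding zero_one by (auto split: if_splits)
  have nonempty: "elems (A ! i) \<noteq> {}" if i: "2 \<le> i" "i < length A" for i
  proof -
    obtain k where k: "?J ! i = Suc (Suc k)" "Suc k < length m" "K < msum m (Suc k)"
      using upper[OF i] by blast
    have "msum m k < msum m (Suc k)"
      by (rule msum_strict_mono[OF m]) (use k in auto)
    then have "card (elems (A ! i)) \<noteq> 0"
      unfolding nth[OF i(2)] block.sel k(1) exact[OF k(2)] using k(3) by linarith
    then show ?thesis
      by auto
  qed
  have disjoint: "elems (A ! i) \<inter> elems (A ! j) = {}" if "i < length A" "j < length A" "i \<noteq> j" for i j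
    using that nth inj by auto
  have nonhom: "\<not> is_hom (A ! i)" if "i < length A" for i
    using nth[OF that] by simp
  have sbp: "skewed_binary_partition n A"
    unfolding skewed_binary_partition_def
  proof (intro conjI allI impI)
    show "(\<Union>X \<in> set A. elems X) = {0..n}" by (rule union)
    show "2 \<le> length A" by (rule lenA)
    show "\<not> is_hom (A ! 0)" using A0 by simp
    show "is_hom (A ! 1)" if "2 \<le> card (elems (A ! 1))"
      using that unfolding A1 block.sel zero_one by (simp split: if_splits)
    show "0 \<in> elems (A ! 0) \<union> elems (A ! 1)"
      using zero_one zero_zero unfolding A0 A1 block.sel by auto
    show "2 \<le> card (elems (A ! 0))" if "0 \<in> elems (A ! 0)"
      using that zero_zero card_zero unfolding A0 block.sel by auto
    show "elems (A ! 1) = {}" if "0 \<in> elems (A ! 0)"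
      using that zero_zero zero_one unfolding A0 A1 block.sel by auto
  qed (use disjoint nonhom nonempty in auto)
  have type_drop: "map (\<lambda>X. if is_hom X then Star (card (elems X)) else Plain (card (elems X))) (drop 2 A) =
      map (\<lambda>i. Plain (msum m i - max (msum m (i - 1)) K)) (filter (\<lambda>i. K < msum m i) [1..<length m])"
  proof -
    have "drop 2 A = map (\<lambda>i. Nonhom {x \<in> {0..n}. L x = Suc i})
        (filter (\<lambda>i. K < msum m i) [1..<length m])"
      by (simp add: A_def level_list_def)
    moreover have "card {x \<in> {0..n}. L x = Suc i} = msum m i - max (msum m (i - 1)) K"
      if "1 \<le> i" "i < length m" for i
      using exact[of "i - 1"] that by simp
    ultimately show ?thesis
      by simp
  qed
  have type: "sbp_type A = level_type m K"
    unfolding sbp_type_def level_type_def type_drop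
    unfolding A0 A1 block.sel zero_one card_zero by simp
  have "L x = ?J ! block_index A x" if "x \<le> n" for x
    using block_index[OF sbp that] nth by auto
  moreover have "block_index A x < length ?J" if "x \<le> n" for x
    using block_index[OF sbp that] len by simp
  ultimately have "block_index A p < block_index A q \<longleftrightarrow> L p < L q" if "p \<le> n" "q \<le> n" for p q
    using level_list_less_iff that by metis
  moreover have "\<not> is_hom (A ! block_index A x)" if "x \<le> n" for x
    using nonhom block_index[OF sbp that] by simp
  ultimately have "sbp_preorder n A = layered_preorder {0..n} L (\<lambda>_. False)"
    unfolding sbp_preorder_layered[OF sbp] layered_preorder_def by (simp cong: conj_cong)
  then show ?thesis
    using sbp type by blast
qed

text \<open>Contraction sees \<open>A\<close> only through its preorder, so \<open>A\<close> can be
  traded for \<open>K\<close> and \<open>L\<close>; the three conditions come from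
  \<open>contraction_layered_iff\<close>.\<close>

lemma SBP_iff_level_function:
  assumes m: "multiplicity_vector n m" and B: "skewed_binary_partition n B"
  shows "B \<in> SBP m \<longleftrightarrow> (\<exists>K L. m ! 0 \<le> K \<and> K \<le> n \<and> level_function m K L \<and>
    (\<forall>p\<le>n. \<forall>q\<le>n. L p < L q \<longrightarrow> block_index B p < block_index B q \<or>
       (block_index B p = block_index B q \<and> is_hom (B ! block_index B p))) \<and>
    (\<forall>p\<le>n. \<forall>q\<le>n. block_index B p < block_index B q \<and> L p = L q \<longrightarrow>
       is_hom (B ! block_index B p) \<or> is_hom (B ! block_index B q)) \<and>
    (\<forall>p\<le>n. is_hom (B ! block_index B p) \<longrightarrow>
       (\<exists>z\<le>n. block_index B z = block_index B p \<and> L z \<noteq> L p)))"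
proof -
  have n: "sum_list m = n"
    using m by (simp add: multiplicity_vector_def)
  have contr: "preorder_contraction {0..n} (sbp_preorder n B) (layered_preorder {0..n} L (\<lambda>_. False))
      \<longleftrightarrow>
    (\<forall>p\<le>n. \<forall>q\<le>n. L p < L q \<longrightarrow> block_index B p < block_index B q \<or>
       (block_index B p = block_index B q \<and> is_hom (B ! block_index B p))) \<and>
    (\<forall>p\<le>n. \<forall>q\<le>n. block_index B p < block_index B q \<and> L p = L q \<longrightarrow>
       is_hom (B ! block_index B p) \<or> is_hom (B ! block_index B q)) \<and>
    (\<forall>p\<le>n. is_hom (B ! block_index B p) \<longrightarrow>
       (\<exists>z\<le>n. block_index B z = block_index B p \<and> L z \<noteq> L p))" for L
    using contraction_layered_iff[of "{0..n}" "\<lambda>i. is_hom (B ! i)" "block_index B" L]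
      hom_block_nontrivial[OF B]
    unfolding sbp_preorder_layered[OF B] by (simp add: Ball_def Bex_def)
  have "B \<in> SBP m \<longleftrightarrow> (\<exists>K L. m ! 0 \<le> K \<and> K \<le> n \<and> level_function m K L \<and>
      preorder_contraction {0..n} (sbp_preorder n B) (layered_preorder {0..n} L (\<lambda>_. False)))"
  proof
    assume "B \<in> SBP m"
    then obtain A where A: "skewed_binary_partition n A" "sbp_type A \<in> Omega m"
      "preorder_contraction {0..n} (sbp_preorder n B) (sbp_preorder n A)"
      by (auto simp: SBP_def sbp_contraction_def n)
    then obtain K where K: "m ! 0 \<le> K" "K \<le> n" "sbp_type A = level_type m K"
      using Omega_eq[OF m] by auto
    then obtain L where "level_function m K L"
      "sbp_preorder n A = layered_preorder {0..n} L (\<lambda>_. False)"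
      using level_function_of_partition[OF m A(1)] by blast
    then show "\<exists>K L. m ! 0 \<le> K \<and> K \<le> n \<and> level_function m K L \<and>
      preorder_contraction {0..n} (sbp_preorder n B) (layered_preorder {0..n} L (\<lambda>_. False))"
      using A(3) K by metis
  next
    assume "\<exists>K L. m ! 0 \<le> K \<and> K \<le> n \<and> level_function m K L \<and>
      preorder_contraction {0..n} (sbp_preorder n B) (layered_preorder {0..n} L (\<lambda>_. False))"
    then obtain K L where K: "m ! 0 \<le> K" "K \<le> n" "level_function m K L"
      "preorder_contraction {0..n} (sbp_preorder n B) (layered_preorder {0..n} L (\<lambda>_. False))"
      by blast
    obtain A where A: "skewed_binary_partition n A" "sbp_type A = level_type m K"
      "sbp_preorder n A = layered_preorder {0..n} L (\<lambda>_. False)"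
      using partition_of_level_function[OF m K(3,1,2)] by blast
    have "sbp_type A \<in> Omega m"
      unfolding Omega_eq[OF m] A(2) using K by auto
    then show "B \<in> SBP m"
      using A K(4) B by (auto simp: SBP_def sbp_contraction_def n)
  qed
  then show ?thesis
    unfolding contr .
qed

section \<open>Comparing levels and blocks\<close>

lemma card_Collect_less:
  fixes n :: nat
  assumes "\<And>y. y \<le> n \<Longrightarrow> P y \<Longrightarrow> Q y" "x \<le> n" "Q x" "\<not> P x"
  shows "card {y \<in> {0..n}. P y} < card {y \<in> {0..n}. Q y}"
  by (rule psubset_card_mono) (use assms in auto)

lemma card_Collect_mono:
  fixes n :: nat
  assumes "\<And>y. y \<le> n \<Longrightarrow> P y \<Longrightarrow> Q y"
  shows "card {y \<in> {0..n}. P y} \<le> card {y \<in> {0..n}. Q y}"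
  by (rule card_mono) (use assms in auto)

locale partition_with_multiplicities =
  fixes n l p :: nat and m :: "nat list" and B :: "block list"
  assumes mult: "multiplicity_vector n m" and length_m: "length m = Suc l"
    and sbp: "skewed_binary_partition n B" and length_B: "length B = p + 2"
begin

abbreviation ix :: "nat \<Rightarrow> nat" where "ix \<equiv> block_index B"
abbreviation hom :: "nat \<Rightarrow> bool" where "hom i \<equiv> is_hom (B ! i)"
abbreviation bs :: "nat \<Rightarrow> nat" where "bs \<equiv> bsum (sbp_type B)"

section \<open>Blocks of \<open>B\<close>, their labels and their partial sums\<close>

lemma elems: "i < p + 2 \<Longrightarrow> elems (B ! i) = {x \<in> {0..n}. ix x = i}"
  using elems_block[OF sbp] length_B by simp

lemma ix_less: "x \<le> n \<Longrightarrow> ix x < p + 2"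
  using block_index(1)[OF sbp] length_B by simp

lemma ix_zero: "ix 0 \<le> 1"
proof -
  have "0 \<in> elems (B ! 0) \<union> elems (B ! 1)"
    using sbp by (simp add: skewed_binary_partition_def)
  then show ?thesis
    using elems[of 0] elems[of 1] by auto
qed

lemma ix_zero_first:
  assumes "ix 0 = 0"
  shows "x \<le> n \<Longrightarrow> ix x \<noteq> 1" "\<exists>y\<le>n. y \<noteq> 0 \<and> ix y = 0"
proof -
  have "0 \<in> elems (B ! 0)"
    using assms elems[of 0] by simp
  then have *: "card (elems (B ! 0)) \<ge> 2" "elems (B ! 1) = {}"
    using sbp by (auto simp: skewed_binary_partition_def)
  then show "x \<le> n \<Longrightarrow> ix x \<noteq> 1"
    using elems[of 1] by auto
  show "\<exists>y\<le>n. y \<noteq> 0 \<and> ix y = 0"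
  proof (rule ccontr)
    assume "\<not> ?thesis"
    then have "elems (B ! 0) \<subseteq> {0}"
      using elems[of 0] by auto
    then have "card (elems (B ! 0)) \<le> card {0::nat}"
      by (rule card_mono[rotated]) simp
    then show False
      using * by simp
  qed
qed

lemma not_hom_0: "\<not> hom 0"
  using sbp by (simp add: skewed_binary_partition_def)

lemma hom_1:
  assumes "x \<le> n" "y \<le> n" "ix x = 1" "ix y = 1" "x \<noteq> y"
  shows "hom 1"
proof -
  have "{x, y} \<subseteq> elems (B ! 1)"
    using assms elems[of 1] by auto
  then have "card {x, y} \<le> card (elems (B ! 1))"
    using sbp_finite_elems[OF sbp, of 1] length_B by (intro card_mono) auto
  then show ?thesis
    using assms(5) sbp by (simp add: skewed_binary_partition_def)
qed

lemma block_nonempty: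
  assumes "2 \<le> i" "i < p + 2"
  shows "\<exists>x\<le>n. ix x = i"
proof -
  have "elems (B ! i) \<noteq> {}"
    using assms sbp length_B by (simp add: skewed_binary_partition_def)
  then show ?thesis
    using elems[OF assms(2)] by auto
qed

lemma hom_nontrivial:
  assumes "x \<le> n" "hom (ix x)"
  shows "\<exists>y\<le>n. y \<noteq> x \<and> ix y = ix x"
  using hom_block_nontrivial[OF sbp assms] by auto

lemma bsum_0: "bs 0 = absval (sbp_type B ! 0) + absval (sbp_type B ! 1)"
  by (simp add: bsum_def)

lemma bsum_Suc: "bs (Suc j) = bs j + absval (sbp_type B ! (j + 2))"
  by (simp add: bsum_def)

text \<open>The extra 1 is the element \<open>0\<close>, left out of the entry of the block that
  contains it. The sum \<open>bs j\<close> ends at list position \<open>j + 1\<close>.\<close>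

lemma card_upto:
  assumes "j \<le> p"
  shows "card {x \<in> {0..n}. ix x \<le> Suc j} = Suc (bs j)"
  using assms
proof (induction j)
  case 0
  have "{x \<in> {0..n}. ix x \<le> Suc 0} = elems (B ! 0) \<union> elems (B ! 1)"
    using elems[of 0] elems[of 1] by auto
  moreover have "card (elems (B ! 0) \<union> elems (B ! 1)) = card (elems (B ! 0)) + card (elems (B ! 1))"
    by (rule card_Un_disjoint) (use elems[of 0] elems[of 1] in auto)
  moreover have "card (elems (B ! 0)) + card (elems (B ! 1)) = Suc (bs 0)"
  proof (cases "0 \<in> elems (B ! 1)")
    case True
    then have "card (elems (B ! 1)) > 0"
      using elems[of 1] by (auto simp: card_gt_0_iff)
    then show ?thesis
      unfolding bsum_0 sbp_type_0 sbp_type_1 using True by simp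
  next
    case False
    then have "0 \<in> elems (B ! 0)"
      using sbp by (auto simp: skewed_binary_partition_def)
    then have "card (elems (B ! 0)) \<ge> 2" "elems (B ! 1) = {}"
      using sbp by (auto simp: skewed_binary_partition_def)
    then show ?thesis
      unfolding bsum_0 sbp_type_0 sbp_type_1 using False by simp
  qed
  ultimately show ?case by simp
next
  case (Suc j)
  have "absval (sbp_type B ! (j + 2)) = card {x \<in> {0..n}. ix x = j + 2}"
    using sbp_type_nth[of "j + 2" B] elems[of "j + 2"] Suc.prems length_B by simp
  moreover have "{x \<in> {0..n}. ix x \<le> Suc (Suc j)} =
      {x \<in> {0..n}. ix x \<le> Suc j} \<union> {x \<in> {0..n}. ix x = j + 2}"
    by auto
  moreover have "card ({x \<in> {0..n}. ix x \<le> Suc j} \<union> {x \<in> {0..n}. ix x = j + 2}) =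
      card {x \<in> {0..n}. ix x \<le> Suc j} + card {x \<in> {0..n}. ix x = j + 2}"
    by (rule card_Un_disjoint) auto
  ultimately show ?case
    using Suc by (simp add: bsum_Suc)
qed

lemma bsum_less:
  assumes "1 \<le> j" "j \<le> p"
  shows "bs (j - 1) < bs j"
proof -
  obtain x where "x \<le> n" "ix x = Suc j"
    using block_nonempty[of "Suc j"] assms by auto
  then have "card {x \<in> {0..n}. ix x \<le> Suc (j - 1)} < card {x \<in> {0..n}. ix x \<le> Suc j}"
    using assms(1) by (intro card_Collect_less[of n _ _ x]) auto
  then show ?thesis
    using card_upto[of j] card_upto[of "j - 1"] assms(2) by simp
qed

lemma bsum_mono:
  assumes "i \<le> j"
  shows "bs i \<le> bs j"
  unfolding bsum_def by (rule sum_mono2) (use assms in auto)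

lemma bsum_final: "bs p = n"
proof -
  have "{x \<in> {0..n}. ix x \<le> Suc p} = {0..n}"
    using ix_less by fastforce
  then show ?thesis
    using card_upto[of p] by simp
qed

lemma m0_less: "m ! 0 < n"
proof -
  have "length m \<ge> 2"
    using mult by (simp add: multiplicity_vector_def)
  then show ?thesis
    using msum_strict_mono[OF mult, of 0 "length m - 1"] msum_last[OF mult]
    by (simp add: msum_0 length_m)
qed

lemma type_1_eq: "sbp_type B ! 1 = Plain 0 \<longleftrightarrow> ix 0 = 0"
  using elems[of 1] ix_zero unfolding sbp_type_1 by auto

text \<open>These blocks are nonempty and homogeneous ones have at least two elements, so the label
  alone decides between the two forms in condition (3).\<close>

lemma type_block:
  assumes "1 \<le> j" "j \<le> p"
  shows "(\<exists>a > 0. sbp_type B ! (j + 1) = Plain a) \<longleftrightarrow> \<not> hom (Suc j)"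
    and "sbp_type B ! (j + 1) \<in> P_star_ge2 \<longleftrightarrow> hom (Suc j)"
proof -
  have E: "elems (B ! Suc j) = {x \<in> {0..n}. ix x = Suc j}"
    using elems assms by simp
  obtain x where x: "x \<le> n" "ix x = Suc j"
    using block_nonempty[of "Suc j"] assms by auto
  then have pos: "card (elems (B ! Suc j)) > 0"
    unfolding E by (auto simp: card_gt_0_iff)
  have two: "card (elems (B ! Suc j)) \<ge> 2" if "hom (Suc j)"
  proof -
    have "card (elems (B ! Suc j)) \<noteq> 1"
      using that sbp assms length_B by (auto simp: skewed_binary_partition_def)
    then show ?thesis
      using pos by linarith
  qed
  have "sbp_type B ! (j + 1) = (if hom (Suc j) then Star (card (elems (B ! Suc j)))
      else Plain (card (elems (B ! Suc j))))"
    using sbp_type_nth[of "j + 1" B] assms length_B by simp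
  then show "(\<exists>a > 0. sbp_type B ! (j + 1) = Plain a) \<longleftrightarrow> \<not> hom (Suc j)"
    "sbp_type B ! (j + 1) \<in> P_star_ge2 \<longleftrightarrow> hom (Suc j)"
    using pos two by (auto simp: P_star_ge2_def)
qed

text \<open>Carries the range of \<open>i\<close> with it; the strict inequality in
  \<open>block_within\<close> comes from \<open>bsum_less\<close>.\<close>

definition within :: "nat \<Rightarrow> nat \<Rightarrow> bool" where
  "within i j \<longleftrightarrow> 1 \<le> i \<and> i \<le> l \<and> msum m (i - 1) \<le> bs (j - 1) \<and> bs j \<le> msum m i"

text \<open>The conditions of \<open>contraction_layered_iff\<close> for merging the levels
  \<open>L\<close> into the blocks of \<open>B\<close>.\<close>

definition compatible :: "(nat \<Rightarrow> nat) \<Rightarrow> bool" where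
  "compatible L \<longleftrightarrow>
    (\<forall>p\<le>n. \<forall>q\<le>n. L p < L q \<longrightarrow> ix p < ix q \<or> (ix p = ix q \<and> hom (ix p))) \<and>
    (\<forall>p\<le>n. \<forall>q\<le>n. ix p < ix q \<and> L p = L q \<longrightarrow> hom (ix p) \<or> hom (ix q)) \<and>
    (\<forall>p\<le>n. hom (ix p) \<longrightarrow> (\<exists>z\<le>n. ix z = ix p \<and> L z \<noteq> L p))"

text \<open>Conditions (1) to (3) in terms of list positions and labels. For \<open>p = 0\<close>
  the inequality in (2) reads \<open>m ! 0 < n\<close>, which is \<open>m0_less\<close>.\<close>

definition type_conditions :: bool where
  "type_conditions \<longleftrightarrow>
    (0 < bs 0 \<and> bs 0 \<le> m ! 0 \<longleftrightarrow> ix 0 = 0) \<and>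
    (p \<ge> 1 \<longrightarrow> m ! 0 < bs 1) \<and>
    (\<forall>i j j'. 1 \<le> j \<and> j \<le> p \<and> 1 \<le> j' \<and> j' \<le> p \<and> within i j \<and> within i j' \<longrightarrow> j = j') \<and>
    (\<forall>j. 1 \<le> j \<and> j \<le> p \<longrightarrow> (\<exists>i. within i j) = (\<not> hom (Suc j)))"

text \<open>Counting shows that \<open>within i j\<close> forces the whole block onto level
  \<open>Suc i\<close>. A homogeneous block cannot stay on one level, two antichain blocks cannot
  share one, and an antichain block has constant level, from which its \<open>i\<close> is read
  off.\<close>

lemma compatible_imp_conditions:
  assumes K: "m ! 0 \<le> K" "K \<le> n" and L: "level_function m K L" and comp: "compatible L"
  shows type_conditions
proof -
  have n: "sum_list m = n"
    using mult by (simp add: multiplicity_vector_def)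
  have start: "if K = m ! 0 \<and> 0 < K then L 0 = 0 \<and> (\<forall>x\<le>n. L x \<noteq> 1) else \<forall>x\<le>n. L x = 1 \<longleftrightarrow> x = 0"
    and bound: "\<And>x. x \<le> n \<Longrightarrow> L x \<le> Suc l"
    and count: "\<And>i. i \<le> l \<Longrightarrow> card {x \<in> {0..n}. L x \<le> Suc i} = Suc (max (msum m i) K)"
    using L unfolding level_function_def n length_m less_Suc_eq_le by blast+
  have start1: "L 0 = 0" "\<And>x. x \<le> n \<Longrightarrow> L x \<noteq> 1" if "K = m ! 0 \<and> 0 < K"
    using start that by auto
  have start2: "L x = 1 \<longleftrightarrow> x = 0" if "\<not> (K = m ! 0 \<and> 0 < K)" "x \<le> n" for x
    using start that by auto
  have ext: "\<And>x y. x \<le> n \<Longrightarrow> y \<le> n \<Longrightarrow> L x < L y \<Longrightarrow> ix x < ix y \<or> (ix x = ix y \<and> hom (ix x))"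
    and split: "\<And>x y. x \<le> n \<Longrightarrow> y \<le> n \<Longrightarrow> ix x < ix y \<Longrightarrow> L x = L y \<Longrightarrow> hom (ix x) \<or> hom (ix y)"
    and spread: "\<And>x. x \<le> n \<Longrightarrow> hom (ix x) \<Longrightarrow> \<exists>z\<le>n. ix z = ix x \<and> L z \<noteq> L x"
    using comp unfolding compatible_def by blast+
  have const: "L x = L y" if "x \<le> n" "y \<le> n" "ix x = ix y" "\<not> hom (ix x)" for x y
    using ext[of x y] ext[of y x] that by (metis less_irrefl linorder_neqE_nat)
  have le: "ix x \<le> ix y" if "x \<le> n" "y \<le> n" "L x < L y" for x y
    using ext[OF that] by auto
  have card0: "card {x \<in> {0..n}. L x \<le> 1} = Suc K"
    using count[of 0] K by (simp add: msum_0 max_def)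
  \<comment> \<open>Otherwise some \<open>x\<close> and \<open>y\<close> have
    \<open>L x < L y\<close> but \<open>ix y < ix x\<close>. Nestedness lets cardinalities decide
    which down-set contains the other.\<close>
  have dich: "(\<forall>x\<le>n. L x \<le> t \<longrightarrow> ix x \<le> s) \<or> (\<forall>x\<le>n. ix x \<le> s \<longrightarrow> L x \<le> t)" for s t
  proof (rule ccontr)
    assume "\<not> ?thesis"
    then obtain x y where "x \<le> n" "L x \<le> t" "s < ix x" "y \<le> n" "ix y \<le> s" "t < L y"
      by (auto simp: not_le)
    then show False
      using le[of x y] by linarith
  qed
  have levels_below: "ix x \<le> s" if "card {x \<in> {0..n}. L x \<le> t} \<le> card {x \<in> {0..n}. ix x \<le> s}"
    "x \<le> n" "L x \<le> t" for x s t
  proof (rule ccontr)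
    assume "\<not> ix x \<le> s"
    then have "card {x \<in> {0..n}. ix x \<le> s} < card {x \<in> {0..n}. L x \<le> t}"
      using dich[of t s] that(2,3) by (intro card_Collect_less[of n _ _ x]) auto
    then show False
      using that(1) by linarith
  qed
  have blocks_below: "L x \<le> t" if "card {x \<in> {0..n}. ix x \<le> s} \<le> card {x \<in> {0..n}. L x \<le> t}"
    "x \<le> n" "ix x \<le> s" for x s t
  proof (rule ccontr)
    assume "\<not> L x \<le> t"
    then have "card {x \<in> {0..n}. L x \<le> t} < card {x \<in> {0..n}. ix x \<le> s}"
      using dich[of t s] that(2,3) by (intro card_Collect_less[of n _ _ x]) auto
    then show False
      using that(1) by linarith
  qed
  \<comment> \<open>With \<open>0\<close> alone on level 1, everything on level 0 lies in the first
    two blocks.\<close>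
  have high2: "2 \<le> L x" if "\<not> (K = m ! 0 \<and> 0 < K)" "x \<le> n" "2 \<le> ix x" for x
  proof (rule ccontr)
    assume "\<not> 2 \<le> L x"
    moreover have "L x \<noteq> 1"
      using start2[OF that(1,2)] that(3) ix_zero by auto
    moreover have "L 0 = 1"
      using start2[OF that(1), of 0] by simp
    ultimately show False
      using le[of x 0] that ix_zero by auto
  qed
  \<comment> \<open>If \<open>x\<close> shared level 0 with \<open>0\<close>, the block of
    \<open>0\<close> would be homogeneous and reach a higher level, yet come before the block of
    \<open>x\<close>.\<close>
  have high1: "L x \<noteq> 0" if case1: "K = m ! 0 \<and> 0 < K" "x \<le> n" "2 \<le> ix x" "\<not> hom (ix x)" for x
  proof
    assume "L x = 0"
    then have "hom (ix 0)"
      using split[of 0 x] start1(1)[OF that(1)] that ix_zero by auto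
    then obtain z where "z \<le> n" "ix z = ix 0" "L z \<noteq> 0"
      using spread[of 0] start1(1)[OF case1(1)] by auto
    then show False
      using le[of x z] \<open>L x = 0\<close> that ix_zero by auto
  qed
  have high: "2 \<le> L x" if "x \<le> n" "2 \<le> ix x" "\<not> hom (ix x)" for x
    using high2[of x] high1[of x] start1(2)[of x] that
    by (metis One_nat_def Suc_1 less_2_cases not_le)
  have cond1: "0 < bs 0 \<and> bs 0 \<le> m ! 0 \<longleftrightarrow> ix 0 = 0"
  proof (cases "K = m ! 0 \<and> 0 < K")
    case True
    show ?thesis
    proof
      assume "ix 0 = 0"
      then obtain y where y: "y \<le> n" "y \<noteq> 0" "ix y = 0"
        using ix_zero_first(2) by blast
      have "{0, y} \<subseteq> {x \<in> {0..n}. ix x \<le> Suc 0}"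
        using y \<open>ix 0 = 0\<close> by auto
      then have "card {0, y} \<le> card {x \<in> {0..n}. ix x \<le> Suc 0}"
        by (intro card_mono) auto
      then have "0 < bs 0"
        using card_upto[of 0] y by simp
      have i0: "ix x = 0" if "x \<le> n" "ix x \<le> 1" for x
        using ix_zero_first(1)[OF \<open>ix 0 = 0\<close> that(1)] that by linarith
      have "L x = 0" if "x \<le> n" "ix x \<le> 1" for x
        using const[of x 0] start1(1)[OF True] \<open>ix 0 = 0\<close> not_hom_0 that(1) i0[OF that] by simp
      then have "card {x \<in> {0..n}. ix x \<le> Suc 0} \<le> card {x \<in> {0..n}. L x \<le> 1}"
        by (intro card_Collect_mono) auto
      then show "0 < bs 0 \<and> bs 0 \<le> m ! 0"
        using card_upto[of 0] card0 \<open>0 < bs 0\<close> True by simp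
    next
      \<comment> \<open>If \<open>0\<close> were in the second block, both initial blocks would lie
        on level 0. The second would then be an antichain, hence \<open>{0}\<close>, and the first
        would share level 0 with it, contrary to \<open>split\<close>.\<close>
      assume b: "0 < bs 0 \<and> bs 0 \<le> m ! 0"
      show "ix 0 = 0"
      proof (rule ccontr)
        assume "ix 0 \<noteq> 0"
        then have i0: "ix 0 = 1"
          using ix_zero by linarith
        have "card {x \<in> {0..n}. ix x \<le> Suc 0} \<le> card {x \<in> {0..n}. L x \<le> 1}"
          using card_upto[of 0] card0 b K by simp
        then have "L x \<le> 1" if "x \<le> n" "ix x \<le> 1" for x
          using blocks_below[of "Suc 0" 1 x] that by simp
        then have L0: "L x = 0" if "x \<le> n" "ix x \<le> 1" for x
          using start1(2)[OF True] that by (metis One_nat_def le_Suc_eq le_zero_eq)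
        then have nh: "\<not> hom 1"
          using spread[of 0] i0 by force
        have "\<exists>x\<le>n. ix x \<le> 1 \<and> x \<noteq> 0"
        proof (rule ccontr)
          assume "\<not> ?thesis"
          then have "{x \<in> {0..n}. ix x \<le> Suc 0} \<subseteq> {0}"
            by auto
          then have "card {x \<in> {0..n}. ix x \<le> Suc 0} \<le> card {0::nat}"
            by (rule card_mono[rotated]) simp
          then show False
            using b card_upto[of 0] by simp
        qed
        then obtain x where x: "x \<le> n" "ix x \<le> 1" "x \<noteq> 0" by blast
        then have "ix x \<noteq> 1"
          using hom_1[of x 0] nh i0 by auto
        then have "ix x = 0"
          using x by linarith
        then show False
          using split[of x 0] x i0 L0 nh not_hom_0 by auto
      qed
    qed
  next
    case False
    have L0: "L 0 = 1"
      using start2[OF False, of 0] by simp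
    have "ix 0 \<noteq> 0"
    proof
      assume "ix 0 = 0"
      then obtain y where y: "y \<le> n" "y \<noteq> 0" "ix y = 0"
        using ix_zero_first(2) by blast
      then have "L y = L 0"
        using const[of y 0] not_hom_0 \<open>ix 0 = 0\<close> by simp
      then show False
        using start2[OF False y(1)] y(2) L0 by simp
    qed
    moreover have "\<not> (0 < bs 0 \<and> bs 0 \<le> m ! 0)"
    proof
      assume b: "0 < bs 0 \<and> bs 0 \<le> m ! 0"
      have "ix x \<le> 1" if "x \<le> n" "L x \<le> 1" for x
      proof (cases "x = 0")
        case True
        then show ?thesis
          using ix_zero by simp
      next
        case x: False
        then have "L x < L 0"
          using start2[OF False that(1)] that(2) L0 by linarith
        then show ?thesis
          using le[of x 0] that(1) ix_zero by auto
      qed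
      then have "card {x \<in> {0..n}. L x \<le> 1} \<le> card {x \<in> {0..n}. ix x \<le> Suc 0}"
        by (intro card_Collect_mono) auto
      \<comment> \<open>With \<open>b\<close> this squeezes \<open>K\<close> to
        \<open>m ! 0 > 0\<close>, the excluded case.\<close>
      then have "K \<le> bs 0"
        using card_upto[of 0] card0 by simp
      then show False
        using b K False by linarith
    qed
    ultimately show ?thesis by simp
  qed
  \<comment> \<open>Otherwise the block with index 1 stays on levels 0 and 1. By
    \<open>high2\<close> level 1 is empty, so the block has constant level and is an antichain,
    against \<open>high\<close>.\<close>
  have cond2: "m ! 0 < bs 1" if p: "p \<ge> 1"
  proof (rule ccontr)
    assume "\<not> m ! 0 < bs 1"
    then have "card {x \<in> {0..n}. ix x \<le> Suc 1} \<le> card {x \<in> {0..n}. L x \<le> 1}"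
      using card_upto[of 1] that card0 K by simp
    then have low: "L x \<le> 1" if "x \<le> n" "ix x \<le> 2" for x
      using blocks_below[of "Suc 1" 1 x] that by (simp add: numeral_2_eq_2)
    obtain x where x: "x \<le> n" "ix x = 2"
      using block_nonempty[of 2] p by auto
    have one: "K = m ! 0 \<and> 0 < K"
      using high2[of x] low[of x] x by fastforce
    have "L y = 0" if "y \<le> n" "ix y \<le> 2" for y
      using low[OF that] start1(2)[OF one that(1)] by linarith
    then have "\<not> hom (ix x)"
      using spread[of x] x by force
    then show False
      using high[of x] low[of x] x by simp
  qed
  have in_level: "L x = Suc i" if w: "within i j" and j: "1 \<le> j" "j \<le> p" and x: "x \<le> n" "ix x = Suc j"
    for i j x
  proof -
    have i: "1 \<le> i" "i \<le> l" "msum m (i - 1) \<le> bs (j - 1)" "bs j \<le> msum m i"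
      using w by (auto simp: within_def)
    \<comment> \<open>The levels up to \<open>i\<close> hold
      \<open>Suc (max (msum m (i - 1)) K)\<close> elements, so \<open>K\<close> has to be bounded
      along with the partial sum.\<close>
    have "K \<le> bs (j - 1)"
    proof (cases "K = m ! 0 \<and> 0 < K")
      case True
      then show ?thesis
        using i(3) msum_mono[of 0 "i - 1" m] by (simp add: msum_0)
    next
      case False
      have "ix y \<le> 1" if "y \<le> n" "L y \<le> 1" for y
        using high2[OF False that(1)] that(2) by linarith
      then have "card {x \<in> {0..n}. L x \<le> 1} \<le> card {x \<in> {0..n}. ix x \<le> Suc 0}"
        by (intro card_Collect_mono) auto
      then show ?thesis
        using card_upto[of 0] card0 bsum_mono[of 0 "j - 1"] by simp
    qed
    then have "card {x \<in> {0..n}. L x \<le> Suc (i - 1)} \<le> card {x \<in> {0..n}. ix x \<le> Suc (j - 1)}"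
      using count[of "i - 1"] card_upto[of "j - 1"] i j by simp
    then have "\<not> L x \<le> i"
      using levels_below[of "Suc (i - 1)" "Suc (j - 1)" x] x i(1) j(1) by auto
    moreover have "card {x \<in> {0..n}. ix x \<le> Suc j} \<le> card {x \<in> {0..n}. L x \<le> Suc i}"
      using count[of i] card_upto[of j] i j by simp
    then have "L x \<le> Suc i"
      using blocks_below[of "Suc j" "Suc i" x] x by simp
    ultimately show ?thesis by simp
  qed
  have within_nonhom: "\<not> hom (Suc j)" if w: "within i j" "1 \<le> j" "j \<le> p" for i j
  proof
    assume h: "hom (Suc j)"
    obtain x where x: "x \<le> n" "ix x = Suc j"
      using block_nonempty[of "Suc j"] w(2,3) by auto
    then obtain z where "z \<le> n" "ix z = Suc j" "L z \<noteq> L x"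
      using spread[of x] h by auto
    then show False
      using in_level[OF w] x by auto
  qed
  have nonhom_within: "\<exists>i. within i j" if j: "1 \<le> j" "j \<le> p" "\<not> hom (Suc j)" for j
  proof -
    obtain x where x: "x \<le> n" "ix x = Suc j"
      using block_nonempty[of "Suc j"] j by auto
    define i where "i = L x - 1"
    have "2 \<le> L x"
      using high[of x] x j by simp
    then have i: "L x = Suc i" "1 \<le> i" "i \<le> l"
      using bound[OF x(1)] by (auto simp: i_def)
    have "ix y \<le> j" if "y \<le> n" "L y \<le> i" for y
      using ext[OF that(1) x(1)] that i x j(3) by auto
    then have "card {x \<in> {0..n}. L x \<le> Suc (i - 1)} \<le> card {x \<in> {0..n}. ix x \<le> Suc (j - 1)}"
      using i(2) j(1) by (intro card_Collect_mono) auto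
    then have lower: "msum m (i - 1) \<le> bs (j - 1)"
      using count[of "i - 1"] card_upto[of "j - 1"] i j by simp
    have "L y \<le> Suc i" if "y \<le> n" "ix y \<le> Suc j" for y
      using ext[OF x(1) that(1)] that i x j(3) by (metis not_le)
    then have "card {x \<in> {0..n}. ix x \<le> Suc j} \<le> card {x \<in> {0..n}. L x \<le> Suc i}"
      by (intro card_Collect_mono) auto
    then have upper: "bs j \<le> max (msum m i) K"
      using count[of i] card_upto[of j] i j by simp
    have "card {y \<in> {0..n}. L y \<le> Suc (i - 1)} < card {y \<in> {0..n}. L y \<le> Suc i}"
      using x i by (intro card_Collect_less[of n _ _ x]) auto
    \<comment> \<open>Level \<open>Suc i\<close> contains \<open>x\<close>, so the count grows
      there; this removes \<open>K\<close> from the maximum in \<open>upper\<close>.\<close>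
    then have "K < msum m i"
      using count[of i] count[of "i - 1"] i by auto
    then have "within i j"
      using lower upper i by (simp add: within_def)
    then show ?thesis by blast
  qed
  have unique: "\<not> j < j'" if w: "1 \<le> j" "j \<le> p" "1 \<le> j'" "j' \<le> p" "within i j" "within i j'" for i j j'
  proof
    assume "j < j'"
    obtain x where x: "x \<le> n" "ix x = Suc j"
      using block_nonempty[of "Suc j"] w by auto
    obtain y where y: "y \<le> n" "ix y = Suc j'"
      using block_nonempty[of "Suc j'"] w by auto
    have "L x = L y"
      using in_level w x y by simp
    then have "hom (Suc j) \<or> hom (Suc j')"
      using split[of x y] x y \<open>j < j'\<close> by auto
    then show False
      using within_nonhom w by blast
  qed
  show ?thesis
    unfolding type_conditions_def
    using cond1 cond2 within_nonhom nonhom_within unique by (metis linorder_neqE_nat)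
qed


text \<open>The position of \<open>x\<close> in a linear order refining that of the blocks. As ties are broken by value,
  \<open>0\<close> is the first element of its block.\<close>

definition pos :: "nat \<Rightarrow> nat" where
  "pos x = card {y \<in> {0..n}. ix y < ix x \<or> (ix y = ix x \<and> y < x)}"

section \<open>Positions along the blocks, and levels cut from them\<close>

lemma pos_less:
  assumes "x \<le> n" "y \<le> n" "ix x < ix y \<or> (ix x = ix y \<and> x < y)"
  shows "pos x < pos y"
  unfolding pos_def by (rule card_Collect_less[of n _ _ x]) (use assms in auto)

lemma pos_le:
  assumes "x \<le> n"
  shows "pos x \<le> n"
proof -
  have "pos x < card {y \<in> {0..n}. True}"
    unfolding pos_def by (rule card_Collect_less[of n _ _ x]) (use assms in auto)
  then show ?thesis by simp
qed

lemma inj_pos: "inj_on pos {0..n}"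
proof (rule inj_onI)
  fix x y assume xy: "x \<in> {0..n}" "y \<in> {0..n}" "pos x = pos y"
  show "x = y"
  proof (rule ccontr)
    assume "x \<noteq> y"
    then have "(ix x < ix y \<or> ix x = ix y \<and> x < y) \<or> (ix y < ix x \<or> ix y = ix x \<and> y < x)"
      by linarith
    then show False
      using pos_less[of x y] pos_less[of y x] xy by auto
  qed
qed

lemma pos_image: "pos ` {0..n} = {0..n}"
proof (rule endo_inj_surj)
  show "pos ` {0..n} \<subseteq> {0..n}"
    using pos_le by force
qed (simp_all add: inj_pos)

lemma pos_surj:
  assumes "k \<le> n"
  obtains x where "x \<le> n" "pos x = k"
proof -
  have "k \<in> pos ` {0..n}"
    using assms pos_image by simp
  then show thesis
    using that by auto
qed

lemma card_pos_le:
  assumes "k \<le> n"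
  shows "card {x \<in> {0..n}. pos x \<le> k} = Suc k"
proof -
  have "pos ` {x \<in> {0..n}. pos x \<le> k} = {0..k}"
  proof
    show "{0..k} \<subseteq> pos ` {x \<in> {0..n}. pos x \<le> k}"
    proof
      fix i assume "i \<in> {0..k}"
      then obtain x where "x \<le> n" "pos x = i"
        using pos_surj[of i] assms by auto
      then show "i \<in> pos ` {x \<in> {0..n}. pos x \<le> k}"
        using \<open>i \<in> {0..k}\<close> by auto
    qed
  qed auto
  moreover have "inj_on pos {x \<in> {0..n}. pos x \<le> k}"
    by (rule inj_on_subset[OF inj_pos]) auto
  ultimately show ?thesis
    using card_image by fastforce
qed

text \<open>Positions start at 0 and these blocks have \<open>Suc (bs j)\<close> elements, so
  \<open>bs j\<close> is their last position.\<close>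

lemma pos_le_bsum:
  assumes "x \<le> n" "j \<le> p"
  shows "pos x \<le> bs j \<longleftrightarrow> ix x \<le> Suc j"
proof
  assume "ix x \<le> Suc j"
  then have "pos x < card {y \<in> {0..n}. ix y \<le> Suc j}"
    unfolding pos_def by (intro card_Collect_less[of n _ _ x]) (use assms in auto)
  then show "pos x \<le> bs j"
    using card_upto[OF assms(2)] by simp
next
  assume le: "pos x \<le> bs j"
  show "ix x \<le> Suc j"
  proof (rule ccontr)
    assume "\<not> ix x \<le> Suc j"
    then have "card {y \<in> {0..n}. ix y \<le> Suc j} \<le> pos x"
      unfolding pos_def by (intro card_Collect_mono) auto
    then show False
      using card_upto[OF assms(2)] le by simp
  qed
qed

lemma pos_zero:
  assumes "ix 0 = 0"
  shows "pos 0 = 0"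
  using assms by (simp add: pos_def)

lemma pos_zero_le: "pos 0 \<le> bs 0"
  using pos_le_bsum[of 0 0] ix_zero by simp

text \<open>As \<open>L\<close> is monotone along positions, extension only requires antichain
  blocks to have constant level. The conditions provide this, keep antichain blocks on different
  levels and spread homogeneous ones.\<close>

lemma conditions_imp_compatible:
  assumes type_conditions
  shows "\<exists>K L. m ! 0 \<le> K \<and> K \<le> n \<and> level_function m K L \<and> compatible L"
proof -
  have n: "sum_list m = n"
    using mult by (simp add: multiplicity_vector_def)
  have cond1: "0 < bs 0 \<and> bs 0 \<le> m ! 0 \<longleftrightarrow> ix 0 = 0"
    and cond2: "p \<ge> 1 \<Longrightarrow> m ! 0 < bs 1"
    and unique: "\<And>i j j'. 1 \<le> j \<Longrightarrow> j \<le> p \<Longrightarrow> 1 \<le> j' \<Longrightarrow> j' \<le> p \<Longrightarrow> within i j \<Longrightarrow> within i j' \<Longrightarrow> j = j'"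
    and cond3: "\<And>j. 1 \<le> j \<Longrightarrow> j \<le> p \<Longrightarrow> (\<exists>i. within i j) = (\<not> hom (Suc j))"
    using assms unfolding type_conditions_def by blast+
  define K where "K = max (m ! 0) (pos 0)"
  define L where "L x = (if pos x \<le> K then (if K = m ! 0 \<and> 0 < K then 0 else if x = 0 then 1 else 0)
    else Suc (LEAST i. pos x \<le> msum m i))" for x
  have K: "m ! 0 \<le> K" "K \<le> n" "pos 0 \<le> K"
    using m0_less pos_le[of 0] by (auto simp: K_def)
  \<comment> \<open>When level 1 is used, \<open>0\<close> is the last element at a position up to
    \<open>K\<close>; this keeps \<open>L\<close> monotone.\<close>
  have K2: "K = pos 0" if "\<not> (K = m ! 0 \<and> 0 < K)"
    using that unfolding K_def by linarith
  have last: "msum m l = n"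
    using msum_last[OF mult] length_m by simp
  have high: "\<exists>i. L x = Suc i \<and> 1 \<le> i \<and> i \<le> l \<and> msum m (i - 1) < pos x \<and> pos x \<le> msum m i"
    if x: "x \<le> n" "K < pos x" for x
  proof -
    define i where "i = (LEAST i. pos x \<le> msum m i)"
    have ex: "pos x \<le> msum m l"
      using pos_le[OF x(1)] last by simp
    have le: "pos x \<le> msum m i"
      unfolding i_def by (rule LeastI, rule ex)
    have "i \<le> l"
      unfolding i_def by (rule Least_le, rule ex)
    moreover have i1: "1 \<le> i"
      using le x(2) K(1) msum_0[of m] by (cases i) auto
    moreover have "msum m (i - 1) < pos x"
      using not_less_Least[of "i - 1" "\<lambda>i. pos x \<le> msum m i"] i1 by (simp add: i_def[symmetric])
    moreover have "L x = Suc i"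
      using x(2) by (simp add: L_def i_def)
    ultimately show ?thesis
      using le by blast
  qed
  have low: "L x \<le> 1" if "pos x \<le> K" for x
    using that by (simp add: L_def)
  have L_le: "L x \<le> Suc i \<longleftrightarrow> pos x \<le> max (msum m i) K" if "x \<le> n" for x i
  proof (cases "pos x \<le> K")
    case True
    then show ?thesis
      using low[of x] by simp
  next
    case False
    then obtain k where k: "L x = Suc k" "1 \<le> k" "msum m (k - 1) < pos x" "pos x \<le> msum m k"
      using high[of x] \<open>x \<le> n\<close> by auto
    have "k \<le> i \<longleftrightarrow> pos x \<le> msum m i"
    proof
      assume "k \<le> i"
      then show "pos x \<le> msum m i"
        using k(4) msum_mono[of k i m] by linarith
    next
      assume "pos x \<le> msum m i"
      then show "k \<le> i"
        using k(2,3) msum_mono[of i "k - 1" m] by linarith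
    qed
    then show ?thesis
      using k(1) False by (simp add: le_max_iff_disj)
  qed
  have bound: "L x \<le> length m" if "x \<le> n" for x
    using L_le[OF that, of l] pos_le[OF that] last length_m by simp
  have count: "card {x \<in> {0..n}. L x \<le> Suc i} = Suc (max (msum m i) K)" if "i \<le> l" for i
  proof -
    have "{x \<in> {0..n}. L x \<le> Suc i} = {x \<in> {0..n}. pos x \<le> max (msum m i) K}"
      using L_le by auto
    moreover have "max (msum m i) K \<le> n"
      using K(2) msum_mono[OF that, of m] last by simp
    ultimately show ?thesis
      using card_pos_le by simp
  qed
  have one: "L x = 0" if "K = m ! 0 \<and> 0 < K" "pos x \<le> K" for x
    using that by (simp add: L_def)
  have two: "L x = (if x = 0 then 1 else 0)" if "\<not> (K = m ! 0 \<and> 0 < K)" "pos x \<le> K" for x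
    using that unfolding L_def by (simp only: if_True if_False)
  have ge2: "2 \<le> L x" if "x \<le> n" "\<not> pos x \<le> K" for x
    using high[of x] that by auto
  have start: "if K = m ! 0 \<and> 0 < K then L 0 = 0 \<and> (\<forall>x\<le>n. L x \<noteq> 1) else \<forall>x\<le>n. L x = 1 \<longleftrightarrow> x = 0"
  proof (cases "K = m ! 0 \<and> 0 < K")
    case True
    have "L x \<noteq> 1" if "x \<le> n" for x
      using one[OF True, of x] ge2[OF that] by (cases "pos x \<le> K") auto
    then show ?thesis
      using True one[OF True K(3)] by simp
  next
    case False
    have "L x = 1 \<longleftrightarrow> x = 0" if "x \<le> n" for x
      using two[OF False, of x] ge2[OF that] K(3) by (cases "pos x \<le> K"; cases "x = 0") auto
    then show ?thesis
      using False by auto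
  qed
  have level: "level_function m K L"
    unfolding level_function_def n length_m less_Suc_eq_le
    using start bound count unfolding length_m by blast
  have mono: "L x \<le> L y" if x: "x \<le> n" and y: "y \<le> n" and xy: "pos x < pos y" for x y
  proof (cases "pos y \<le> K")
    case True
    show ?thesis
    proof (cases "K = m ! 0 \<and> 0 < K")
      case case1: True
      then show ?thesis
        using one[OF case1, of x] True xy by simp
    next
      case case2: False
      then have "x \<noteq> 0"
        using K2[OF case2] True xy by (cases "x = 0") auto
      then show ?thesis
        using two[OF case2, of x] True xy by simp
    qed
  next
    case False
    then obtain k where k: "L y = Suc k" "pos y \<le> msum m k"
      using high[of y] y by auto
    then show ?thesis
      using L_le[OF x, of k] xy by simp
  qed
  have order: "ix x < ix y \<or> (ix x = ix y \<and> x \<noteq> y)" if x: "x \<le> n" and y: "y \<le> n" and xy: "L x < L y" for x y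
  proof -
    have "x \<noteq> y" "\<not> pos y < pos x"
      using mono[OF y x] xy by auto
    then show ?thesis
      using pos_less[OF y x] by (metis linorder_neqE_nat)
  qed
  \<comment> \<open>If \<open>0\<close> is in the first block, condition (1) keeps that block at
    positions up to \<open>K = m ! 0\<close>; otherwise the block precedes \<open>0\<close>.\<close>
  have block0: "L x = 0" if x: "x \<le> n" "ix x = 0" for x
  proof (cases "ix 0 = 0")
    case True
    have "pos x \<le> bs 0"
      using pos_le_bsum[of x 0] x by simp
    moreover have "0 < bs 0 \<and> bs 0 \<le> m ! 0"
      using cond1 True by simp
    moreover have "K = m ! 0"
      using pos_zero[OF True] by (simp add: K_def)
    ultimately show ?thesis
      by (intro one) auto
  next
    case False
    then have "pos x \<le> K"
      using pos_less[of x 0] x K(3) by simp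
    moreover have "x \<noteq> 0"
      using False x by metis
    ultimately show ?thesis
      using one[of x] two[of x] by metis
  qed
  have zero_low: "L 0 \<le> 1"
    using low K(3) by simp
  have block1: "ix 0 = 1" "\<not> hom 1 \<Longrightarrow> x = 0" if x: "x \<le> n" "ix x = 1" for x
  proof -
    show "ix 0 = 1"
      using ix_zero_first(1)[of x] ix_zero x by linarith
    then show "\<not> hom 1 \<Longrightarrow> x = 0"
      using hom_1[of x 0] x by auto
  qed
  have in_block: "ix x = Suc j \<longleftrightarrow> bs (j - 1) < pos x \<and> pos x \<le> bs j"
    if "x \<le> n" "1 \<le> j" "j \<le> p" for x j
  proof -
    have "pos x \<le> bs j \<longleftrightarrow> ix x \<le> Suc j" "pos x \<le> bs (j - 1) \<longleftrightarrow> ix x \<le> Suc (j - 1)"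
      by (rule pos_le_bsum; use that in linarith)+
    then show ?thesis
      using that(2) by linarith
  qed
  have below: "pos 0 \<le> bs (j - 1)" for j
    using pos_zero_le bsum_mono[of 0 "j - 1"] by simp
  have within_level: "L x = Suc i"
    if w: "within i j" and j: "1 \<le> j" "j \<le> p" and x: "x \<le> n" "ix x = Suc j" for i j x
  proof -
    have i: "1 \<le> i" "msum m (i - 1) \<le> bs (j - 1)" "bs j \<le> msum m i"
      using w by (auto simp: within_def)
    have px: "bs (j - 1) < pos x" "pos x \<le> bs j"
      using in_block[of x j] x j by auto
    have "m ! 0 \<le> msum m (i - 1)"
      using msum_mono[of 0 "i - 1" m] by (simp add: msum_0)
    \<comment> \<open>Both candidates for \<open>K\<close> stay below the block:
      \<open>m ! 0\<close> by \<open>within\<close>, \<open>pos 0\<close> by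
      \<open>below\<close>.\<close>
    then have "\<not> pos x \<le> max (msum m (i - 1)) K"
      using i px below[of j] by (simp add: K_def)
    then have "\<not> L x \<le> Suc (i - 1)"
      using L_le x(1) by simp
    moreover have "L x \<le> Suc i"
      using L_le[OF x(1)] px i by simp
    ultimately show ?thesis
      using i(1) by simp
  qed
  have nonhom_level: "\<exists>i. within i j \<and> (\<forall>x\<le>n. ix x = Suc j \<longrightarrow> L x = Suc i)"
    if j: "1 \<le> j" "j \<le> p" "\<not> hom (Suc j)" for j
    using cond3[OF j(1,2)] within_level j by blast
  have pos_cases: "\<exists>j. ix x = Suc j \<and> 1 \<le> j \<and> j \<le> p" if "x \<le> n" "2 \<le> ix x" for x
    using ix_less[OF that(1)] that(2) by (intro exI[of _ "ix x - 1"]) auto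
  have "hom (ix x)" if x: "x \<le> n" and y: "y \<le> n" and xy: "L x < L y" "ix x = ix y" for x y
  proof (rule ccontr)
    assume nh: "\<not> hom (ix x)"
    consider "ix x = 0" | "ix x = 1" | "2 \<le> ix x" by linarith
    then show False
    proof cases
      case 1
      then show False
        using block0[OF x] block0[OF y] xy by simp
    next
      case 2
      then show False
        using block1(2)[OF x] block1(2)[OF y] nh xy by simp
    next
      case 3
      then obtain j where j: "ix x = Suc j" "1 \<le> j" "j \<le> p"
        using pos_cases[OF x] by blast
      then show False
        using nonhom_level[of j] nh x y xy by auto
    qed
  qed
  then have extends: "ix x < ix y \<or> (ix x = ix y \<and> hom (ix x))" if "x \<le> n" "y \<le> n" "L x < L y" for x y
    using order that by blast
  have split: "hom (ix x) \<or> hom (ix y)" if x: "x \<le> n" and y: "y \<le> n" and xy: "ix x < ix y" "L x = L y" for x y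
  proof (rule ccontr)
    assume nh: "\<not> ?thesis"
    consider "ix y = 1" | "2 \<le> ix y"
      using xy(1) by linarith
    then show False
    proof cases
      case 1
      then have x0: "ix x = 0" and y0: "y = 0" and i0: "ix 0 = 1"
        using xy block1[OF y] nh by auto
      have "L 0 = 0"
        using block0[OF x x0] xy(2) y0 by simp
      then have case1: "K = m ! 0 \<and> 0 < K"
        using two[of 0] K(3) by fastforce
      have "bs 0 \<le> n"
        using bsum_mono[of 0 p] bsum_final by simp
      \<comment> \<open>The last element of the two initial blocks. As the second is
        \<open>{0}\<close>, it cannot come after \<open>0\<close>; so
        \<open>bs 0 \<le> m ! 0\<close>, and condition (1) would put \<open>0\<close> into the first
        block.\<close>
      then obtain z where z: "z \<le> n" "pos z = bs 0"
        using pos_surj by blast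
      have "pos z \<le> pos 0"
      proof (cases "ix z = 0")
        case True
        then show ?thesis
          using pos_less[of z 0] z i0 by simp
      next
        case False
        then have "ix z = 1"
          using pos_le_bsum[of z 0] z by simp
        then show ?thesis
          using block1(2)[OF z(1)] nh y0 i0 by simp
      qed
      then have "bs 0 \<le> m ! 0"
        using z(2) K(3) case1 by simp
      moreover have "pos x < pos 0"
        using pos_less[of x 0] x x0 i0 by simp
      then have "0 < bs 0"
        using pos_zero_le by simp
      ultimately show False
        using cond1 i0 by simp
    next
      case 2
      then obtain j where j: "ix y = Suc j" "1 \<le> j" "j \<le> p"
        using pos_cases[OF y] by blast
      then obtain i where i: "within i j" "L y = Suc i"
        using nonhom_level[of j] nh y by auto
      then have "2 \<le> L x"
        using xy(2) by (auto simp: within_def)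
      consider "ix x = 0" | "ix x = 1" | "2 \<le> ix x" by linarith
      then show False
      proof cases
        case 1
        then show False
          using block0[OF x] \<open>2 \<le> L x\<close> by simp
      next
        case 2
        then show False
          using block1(2)[OF x] nh zero_low \<open>2 \<le> L x\<close> by auto
      next
        case 3
        then obtain j' where j': "ix x = Suc j'" "1 \<le> j'" "j' \<le> p"
          using pos_cases[OF x] by blast
        then obtain i' where "within i' j'" "L x = Suc i'"
          using nonhom_level[of j'] nh x by auto
        then show False
          using unique[of j j' i] i j j' xy by auto
      qed
    qed
  qed
  have spread: "\<exists>z\<le>n. ix z = ix x \<and> L z \<noteq> L x" if x: "x \<le> n" and h: "hom (ix x)" for x
  proof -
    consider "ix x = 0" | "ix x = 1" | "2 \<le> ix x" by linarith
    then show ?thesis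
    proof cases
      case 1
      then show ?thesis
        using h not_hom_0 by simp
    next
      case 2
      have i0: "ix 0 = 1"
        using block1(1)[OF x 2] .
      obtain y where y: "y \<le> n" "y \<noteq> 0" "ix y = 1"
        using hom_nontrivial[of 0] h 2 i0 by auto
      have "pos 0 < pos y"
        using pos_less[of 0 y] y i0 by simp
      moreover have "pos y \<le> bs 0"
        using pos_le_bsum[of y 0] y by simp
      ultimately have b: "pos 0 < bs 0" by linarith
      \<comment> \<open>By condition (1), \<open>m ! 0 < bs 0\<close>; so the last element of this
        block is above level 1, while \<open>0\<close> is not.\<close>
      then have "K < bs 0"
        using cond1 i0 by (auto simp: K_def)
      have "bs 0 \<le> n"
        using bsum_mono[of 0 p] bsum_final by simp
      then obtain z where z: "z \<le> n" "pos z = bs 0"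
        using pos_surj by blast
      have "ix z \<noteq> 0"
        using pos_less[of z 0] z i0 b by auto
      then have "ix z = 1"
        using pos_le_bsum[of z 0] z by simp
      moreover have "L z \<noteq> L 0"
        using ge2[of z] z \<open>K < bs 0\<close> zero_low by auto
      ultimately show ?thesis
        using z(1) i0 2 by (metis le0)
    next
      case 3
      then obtain j where j: "ix x = Suc j" "1 \<le> j" "j \<le> p"
        using pos_cases[OF x] by blast
      show ?thesis
      proof (rule ccontr)
        assume "\<not> ?thesis"
        then have const: "L z = L x" if "z \<le> n" "ix z = Suc j" for z
          using that j(1) by auto
        have less: "bs (j - 1) < bs j" and bn: "bs j \<le> n"
          using bsum_less[of j] bsum_mono[of j p] bsum_final j by auto
        \<comment> \<open>First and last element of the block. On a common level
          \<open>Suc i\<close> they would confine the block to the range of \<open>i\<close>, and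
          (3) makes such a block an antichain.\<close>
        obtain u where u: "u \<le> n" "pos u = Suc (bs (j - 1))"
          using pos_surj[of "Suc (bs (j - 1))"] less bn by auto
        obtain v where v: "v \<le> n" "pos v = bs j"
          using pos_surj[OF bn] by blast
        have iu: "ix u = Suc j" and iv: "ix v = Suc j"
          using in_block[OF u(1) j(2,3)] in_block[OF v(1) j(2,3)] u v less by auto
        \<comment> \<open>Condition (2) enters here: the block does not end at a position up to
          \<open>K\<close>.\<close>
        have "m ! 0 < bs j"
          using cond2 bsum_mono[of 1 j] j by simp
        then have "K < pos v"
          using v below[of j] less by (simp add: K_def)
        then obtain i where i: "L v = Suc i" "1 \<le> i" "i \<le> l" "pos v \<le> msum m i"
          using high[OF v(1)] by auto
        have "L u = Suc i"
          using const[OF u(1) iu] const[OF v(1) iv] i(1) by simp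
        then have "\<not> pos u \<le> max (msum m (i - 1)) K"
          using L_le[OF u(1), of "i - 1"] i(2) by simp
        then have "msum m (i - 1) \<le> bs (j - 1)"
          using u(2) by simp
        then have "within i j"
          using i v by (simp add: within_def)
        then show False
          using cond3[OF j(2,3)] h j(1) by auto
      qed
    qed
  qed
  have "compatible L"
    unfolding compatible_def using extends split spread by blast
  then show ?thesis
    using K level by blast
qed

end

theorem proposition5p20:
  fixes n l p :: nat and m :: "nat list" and B :: "block list" and b :: "type_entry list"
  assumes "multiplicity_vector n m"
    and "length m = l + 1"
    and "skewed_binary_partition n B"
    and "b = sbp_type B"
    and "length b = p + 2"
  shows "B \<in> SBP m \<longleftrightarrow>
    (0 < absval (b ! 0) + absval (b ! 1) \<and> absval (b ! 0) + absval (b ! 1) \<le> m ! 0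
       \<longleftrightarrow> b ! 1 = Plain 0) \<and>
    (m ! 0 < (if p = 0 then absval (b ! 0) + absval (b ! 1)
              else absval (b ! 0) + absval (b ! 1) + absval (b ! 2)) \<and>
     (\<forall>i. 1 \<le> i \<and> i \<le> l \<longrightarrow> (\<exists>\<^sub>\<le>\<^sub>1 j. 1 \<le> j \<and> j \<le> p \<and> block_within m b i j))) \<and>
    (\<forall>j. 1 \<le> j \<and> j \<le> p \<longrightarrow>
       (if \<exists>i. 1 \<le> i \<and> i \<le> l \<and> block_within m b i j
        then \<exists>a > 0. b ! (j + 1) = Plain a
        else b ! (j + 1) \<in> P_star_ge2))"
    (is "_ \<longleftrightarrow> ?c1 \<and> (?c2 \<and> ?u) \<and> ?c3")
proof -
  have "length B \<ge> 2"
    using assms(3) by (simp add: skewed_binary_partition_def)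
  then have "length B = p + 2"
    using assms(4,5) length_sbp_type by metis
  then interpret partition_with_multiplicities n l p m B
    using assms by unfold_locales auto
  have "B \<in> SBP m \<longleftrightarrow> (\<exists>K L. m ! 0 \<le> K \<and> K \<le> n \<and> level_function m K L \<and> compatible L)"
    unfolding SBP_iff_level_function[OF mult sbp] compatible_def ..
  then have "B \<in> SBP m \<longleftrightarrow> type_conditions"
    using compatible_imp_conditions conditions_imp_compatible by blast
  moreover have within: "1 \<le> i \<and> i \<le> l \<and> block_within m b i j \<longleftrightarrow> within i j"
    if "1 \<le> j" "j \<le> p" for i j
    using bsum_less[OF that] by (auto simp: block_within_def within_def assms(4))
  have "?c1 \<longleftrightarrow> (0 < bs 0 \<and> bs 0 \<le> m ! 0 \<longleftrightarrow> ix 0 = 0)"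
    unfolding assms(4) bsum_0 type_1_eq ..
  moreover have "?c2 \<longleftrightarrow> (p \<ge> 1 \<longrightarrow> m ! 0 < bs 1)"
    using bsum_final m0_less bsum_Suc[of 0] by (auto simp: assms(4) bsum_0 numeral_2_eq_2)
  moreover have "?u \<longleftrightarrow> (\<forall>i j j'. 1 \<le> j \<and> j \<le> p \<and> 1 \<le> j' \<and> j' \<le> p \<and> within i j \<and> within i j' \<longrightarrow> j = j')"
  proof
    assume ?u
    then show "\<forall>i j j'. 1 \<le> j \<and> j \<le> p \<and> 1 \<le> j' \<and> j' \<le> p \<and> within i j \<and> within i j' \<longrightarrow> j = j'"
      unfolding Uniq_def by (metis within)
  next
    assume "\<forall>i j j'. 1 \<le> j \<and> j \<le> p \<and> 1 \<le> j' \<and> j' \<le> p \<and> within i j \<and> within i j' \<longrightarrow> j = j'"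
    then show ?u
      unfolding Uniq_def by (metis within)
  qed
  moreover have "?c3 \<longleftrightarrow> (\<forall>j. 1 \<le> j \<and> j \<le> p \<longrightarrow> (\<exists>i. within i j) = (\<not> hom (Suc j)))"
  proof -
    have "(if \<exists>i. 1 \<le> i \<and> i \<le> l \<and> block_within m b i j
        then \<exists>a > 0. b ! (j + 1) = Plain a else b ! (j + 1) \<in> P_star_ge2) \<longleftrightarrow>
        (\<exists>i. within i j) = (\<not> hom (Suc j))" if "1 \<le> j" "j \<le> p" for j
      using within[OF that] type_block[OF that] by (simp add: assms(4))
    then show ?thesis by blast
  qed
  ultimately show ?thesis
    unfolding type_conditions_def by (simp only: conj_assoc)
qed

end
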